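(* Let $p\geq 0$ and let $G$ be a nearly balanced bipartite graph of order $2n-1$ with minimum degree $\delta(G)\geq k$. (i) If $k=p+1$, $n\geq 2k+3$, and $\rho(G)\geq \rho(M_{n,n-1}^{1,n-k-1})$, then $G$ is $2p$-Hamilton-biconnected unless $G= M_{n,n-1}^{1,n-k-1}$. (ii) If $k\geq p+2$, $n\geq \frac{(k+2)(k-p+1)}{2}$, and $\rho(G)\geq \rho(M_{n,n-1}^{n-k,k-p-1})$, then $G$ is $2p$-Hamilton-biconnected unless $G= M_{n,n-1}^{n-k,k-p-1}$.
   Context: $\rho(G)$ is the largest eigenvalue of the adjacency matrix. A bipartite graph $G=(X,Y;E)$ is nearly balanced if $|X|=|Y|+1$; it is Hamilton-biconnected if for any two distinct $u,v\in X$ there is a Hamiltonian path with ends $u,v$. A vertex set $W$ is balanced if $|W\cap X|=|W\cap Y|$; $G$ is $2p$-Hamilton-biconnected if for every balanced $W$ with $|W|=2p$, the subgraph induced by $V(G)\setminus W$ is Hamilton-biconnected. $M_{n,m}^{s,t}$: parts $X=X_1\cup X_2$ (with $n$ vertices), $Y=Y_1\cup Y_2$ (with $m$ vertices), $|X_1|=s$, $|X_2|=n-s$, $|Y_1|=m-t$, $|Y_2|=t$; edges are all pairs between $X_1$ and $Y_1$, between $X_2$ and $Y_1$, and between $X_2$ and $Y_2$. "$G=H$" means isomorphic. *)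

theory Defs
  imports Complex_Main "Jordan_Normal_Form.Char_Poly"
begin

definition bip_graph :: "'a set \<Rightarrow> 'a set \<Rightarrow> 'a set set \<Rightarrow> bool" where
  "bip_graph X Y E \<longleftrightarrow> finite X \<and> finite Y \<and> X \<inter> Y = {} \<and>
     (\<forall>e\<in>E. \<exists>x\<in>X. \<exists>y\<in>Y. e = {x, y})"

definition nearly_balanced :: "'a set \<Rightarrow> 'a set \<Rightarrow> bool" where
  "nearly_balanced X Y \<longleftrightarrow> card X = card Y + 1"

definition degree :: "'a set set \<Rightarrow> 'a \<Rightarrow> nat" where
  "degree E v = card {u. {u, v} \<in> E}"

definition min_degree_ge :: "'a set \<Rightarrow> 'a set set \<Rightarrow> nat \<Rightarrow> bool" where
  "min_degree_ge V E k \<longleftrightarrow> (\<forall>v\<in>V. degree E v \<ge> k)"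

definition ham_path :: "'a set \<Rightarrow> 'a set set \<Rightarrow> 'a \<Rightarrow> 'a \<Rightarrow> bool" where
  "ham_path V E u v \<longleftrightarrow> (\<exists>ps. distinct ps \<and> set ps = V \<and> ps \<noteq> [] \<and>
     hd ps = u \<and> last ps = v \<and> (\<forall>i. Suc i < length ps \<longrightarrow> {ps ! i, ps ! Suc i} \<in> E))"

definition ham_biconnected :: "'a set \<Rightarrow> 'a set \<Rightarrow> 'a set set \<Rightarrow> bool" where
  "ham_biconnected X Y E \<longleftrightarrow>
     (\<forall>u\<in>X. \<forall>v\<in>X. u \<noteq> v \<longrightarrow> ham_path (X \<union> Y) E u v)"

definition del_edges :: "'a set set \<Rightarrow> 'a set \<Rightarrow> 'a set set" where
  "del_edges E W = {e \<in> E. e \<inter> W = {}}"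

definition balanced_set :: "'a set \<Rightarrow> 'a set \<Rightarrow> 'a set \<Rightarrow> bool" where
  "balanced_set X Y W \<longleftrightarrow> card (W \<inter> X) = card (W \<inter> Y)"

definition ham_biconnected_2p :: "nat \<Rightarrow> 'a set \<Rightarrow> 'a set \<Rightarrow> 'a set set \<Rightarrow> bool" where
  "ham_biconnected_2p p X Y E \<longleftrightarrow>
     (\<forall>W. W \<subseteq> X \<union> Y \<and> balanced_set X Y W \<and> card W = 2 * p \<longrightarrow>
        ham_biconnected (X - W) (Y - W) (del_edges E W))"

definition vertex_list :: "'a set \<Rightarrow> 'a list" where
  "vertex_list V = (SOME vs. distinct vs \<and> set vs = V)"

definition adj_matrix :: "'a set \<Rightarrow> 'a set set \<Rightarrow> real mat" where
  "adj_matrix V E = (let vs = vertex_list V in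
     mat (length vs) (length vs) (\<lambda>(i, j). if {vs ! i, vs ! j} \<in> E then 1 else 0))"

definition spec_rad :: "'a set \<Rightarrow> 'a set set \<Rightarrow> real" where
  "spec_rad V E = Max {x. eigenvalue (adj_matrix V E) x}"

definition graph_iso :: "'a set \<Rightarrow> 'a set set \<Rightarrow> 'b set \<Rightarrow> 'b set set \<Rightarrow> bool" where
  "graph_iso V E V' E' \<longleftrightarrow> (\<exists>f. bij_betw f V V' \<and>
     (\<forall>x\<in>V. \<forall>y\<in>V. {x, y} \<in> E \<longleftrightarrow> {f x, f y} \<in> E'))"

text \<open>The graph M_{n,m}^{s,t}: X = {Inl i | i < n} with X1 = {Inl i | i < s},
  Y = {Inr j | j < m} with Y1 = {Inr j | j < m - t}, Y2 = the remaining t vertices.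
  Edges: X1-Y1, X2-Y1, X2-Y2.\<close>
definition M_X :: "nat \<Rightarrow> (nat + nat) set" where
  "M_X n = Inl ` {..<n}"
definition M_Y :: "nat \<Rightarrow> (nat + nat) set" where
  "M_Y m = Inr ` {..<m}"
definition M_E :: "nat \<Rightarrow> nat \<Rightarrow> nat \<Rightarrow> nat \<Rightarrow> (nat + nat) set set" where
  "M_E n m s t = {{Inl i, Inr j} | i j. i < n \<and> j < m \<and>
      ((i < s \<and> j < m - t) \<or> (s \<le> i \<and> j < m - t) \<or> (s \<le> i \<and> m - t \<le> j))}"

end

theory Submission
  imports Defs "HOL-Analysis.Function_Topology"
begin

text \<open>
  Delete a balanced set of \<open>2p\<close> vertices and suppose that two vertices \<open>u, v\<close> of the larger side are
  not joined by a Hamiltonian path. Adding a vertex adjacent to \<open>u\<close> and \<open>v\<close> only gives a balanced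
  bipartite graph with \<open>N = n - p\<close> vertices on each side and without a Hamiltonian cycle. In a maximal
  non-Hamiltonian supergraph, non-adjacent vertices on different sides have degree sum at most \<open>N\<close>;
  a non-adjacent pair of maximal degree sum, with degrees \<open>a\<close> and \<open>b\<close>, yields \<open>N - b\<close> vertices of
  degree at most \<open>a\<close> on one side and \<open>N - a\<close> vertices of degree at most \<open>b\<close> on the other. So either
  \<open>G\<close> misses many edges, or it has a very rigid structure.

  Let \<open>e\<close> be the number of edges and \<open>\<rho>\<close> the spectral radius of \<open>G\<close>. Minimum degree \<open>k\<close> forces
  \<open>(\<rho>\<^sup>2 - e + k card Y) (\<rho>\<^sup>2 - e + k card X) \<le> k\<^sup>2 \<rho>\<^sup>2\<close>, which together with the lower bound on \<open>\<rho>\<close>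
  coming from a complete bipartite subgraph of the extremal graph \<open>M\<close> rules out many missing edges.
  The remaining structures embed \<open>G\<close> into \<open>M\<close>, where \<open>\<rho>(G) \<ge> \<rho>(M)\<close> forces equality because the
  Perron vector of \<open>M\<close> is positive, or (when \<open>k = p + 1\<close>) into another graph of the same shape whose
  spectral radius is smaller.
\<close>

section \<open>Rayleigh quotients of adjacency matrices\<close>

definition adj :: "'a set set \<Rightarrow> 'a \<Rightarrow> 'a \<Rightarrow> real" where
  "adj E u v = of_bool ({u, v} \<in> E)"

text \<open>Working with functions on the vertices avoids the arbitrary vertex order chosen by
  \<open>adj_matrix\<close>; only values on \<open>V\<close> matter.\<close>

definition eigenfun :: "'a set \<Rightarrow> 'a set set \<Rightarrow> real \<Rightarrow> ('a \<Rightarrow> real) \<Rightarrow> bool" where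
  "eigenfun V E r f \<longleftrightarrow> (\<exists>v\<in>V. f v \<noteq> 0) \<and> (\<forall>v\<in>V. (\<Sum>u\<in>V. adj E v u * f u) = r * f v)"

definition qform :: "'a set \<Rightarrow> 'a set set \<Rightarrow> ('a \<Rightarrow> real) \<Rightarrow> real" where
  "qform V E f = (\<Sum>v\<in>V. \<Sum>u\<in>V. adj E v u * f v * f u)"

lemma adj_sym: "adj E u v = adj E v u"
  by (simp add: adj_def insert_commute)

lemma adj_nonneg: "0 \<le> adj E u v"
  by (simp add: adj_def)

lemma adj_mono: "E \<subseteq> E' \<Longrightarrow> adj E u v \<le> adj E' u v"
  by (auto simp: adj_def)

lemma qform_scale: "qform V E (\<lambda>v. c * f v) = c\<^sup>2 * qform V E f"
  by (simp add: qform_def sum_distrib_left power2_eq_square mult_ac)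

lemma qform_eigenfun:
  assumes "eigenfun V E r f"
  shows "qform V E f = r * (\<Sum>v\<in>V. (f v)\<^sup>2)"
proof -
  have "qform V E f = (\<Sum>v\<in>V. f v * (\<Sum>u\<in>V. adj E v u * f u))"
    by (simp add: qform_def sum_distrib_left mult_ac)
  also have "\<dots> = (\<Sum>v\<in>V. f v * (r * f v))"
    using assms by (intro sum.cong) (auto simp: eigenfun_def)
  finally show ?thesis
    by (simp add: sum_distrib_left power2_eq_square mult_ac)
qed

lemma sum_squares_pos:
  fixes f :: "'a \<Rightarrow> real"
  assumes "finite V" "v \<in> V" "f v \<noteq> 0"
  shows "(\<Sum>v\<in>V. (f v)\<^sup>2) > 0"
  using assms by (intro sum_pos2[of V v]) auto

text \<open>The vertex type may be infinite. Freezing the coordinates outside \<open>V\<close> at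
  \<open>0\<close> makes every factor compact, so Tychonoff's theorem applies to the product over
  \<open>UNIV\<close>.\<close>

lemma compact_finite_support_box:
  "compact {f :: 'a \<Rightarrow> real. (\<forall>v\<in>V. f v \<in> {-1..1}) \<and> (\<forall>v. v \<notin> V \<longrightarrow> f v = 0)}"
proof -
  define S where "S = (\<lambda>v. if v \<in> V then {-1..1} else {0 :: real})"
  have "compactin (product_topology (\<lambda>_. euclidean) UNIV) (PiE UNIV S)"
    by (subst compactin_PiE) (auto simp: S_def)
  then have "compact (PiE UNIV S)"
    by (simp add: euclidean_product_topology)
  moreover have "PiE UNIV S = {f. (\<forall>v\<in>V. f v \<in> {-1..1}) \<and> (\<forall>v. v \<notin> V \<longrightarrow> f v = 0)}"
    by (auto simp: S_def PiE_def Pi_def split: if_splits)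
  ultimately show ?thesis by simp
qed

lemma continuous_on_eval: "continuous_on S (\<lambda>f :: 'a \<Rightarrow> real. f v)"
  by (rule continuous_on_subset[OF continuous_on_product_coordinates]) simp

text \<open>The unit sphere of functions supported on \<open>V\<close> is a closed subset of the
  compact box, and \<open>qform\<close> is continuous on it. Homogeneity extends the bound from unit
  vectors to all \<open>g\<close>.\<close>

lemma qform_attains_max:
  assumes "finite V" "V \<noteq> {}"
  obtains f where "(\<Sum>v\<in>V. (f v)\<^sup>2) = 1"
    and "\<And>g. qform V E g \<le> qform V E f * (\<Sum>v\<in>V. (g v)\<^sup>2)"
proof -
  let ?B = "{f :: 'a \<Rightarrow> real. (\<forall>v\<in>V. f v \<in> {-1..1}) \<and> (\<forall>v. v \<notin> V \<longrightarrow> f v = 0)}"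
  let ?N = "\<lambda>f :: 'a \<Rightarrow> real. \<Sum>v\<in>V. (f v)\<^sup>2"
  define S where "S = ?B \<inter> ?N -` {1}"
  have cN: "continuous_on UNIV ?N"
    by (intro continuous_on_sum continuous_on_power continuous_on_eval)
  have "closed (?N -` {1})"
    by (rule closed_vimage[OF closed_singleton cN])
  then have cS: "compact S"
    unfolding S_def by (intro compact_Int_closed compact_finite_support_box)
  have cQ: "continuous_on S (qform V E)"
    unfolding qform_def
    by (intro continuous_on_sum continuous_on_mult continuous_on_const continuous_on_eval)
  \<comment> \<open>\<open>qform\<close> and the norm see only \<open>V\<close>, so a function of
    norm 1 may be replaced by one that is zero outside \<open>V\<close>, which lies in
    \<open>S\<close>.\<close>
  have restr: "(\<lambda>v. if v \<in> V then g v else 0) \<in> S" if g: "?N g = 1" for g :: "'a \<Rightarrow> real"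
  proof -
    have "\<bar>g v\<bar> \<le> 1" if "v \<in> V" for v
    proof -
      have "(g v)\<^sup>2 \<le> ?N g"
        using assms that by (intro member_le_sum) auto
      then show ?thesis
        using g by (simp add: abs_square_le_1)
    qed
    moreover have "?N (\<lambda>v. if v \<in> V then g v else 0) = ?N g"
      by (intro sum.cong) auto
    ultimately show ?thesis
      using g by (simp add: S_def abs_le_iff minus_le_iff)
  qed
  obtain v where v: "v \<in> V" using assms by auto
  have "?N (\<lambda>u. of_bool (u = v)) = 1"
  proof -
    have "?N (\<lambda>u. of_bool (u = v)) = (\<Sum>u\<in>V. if u = v then 1 else 0)"
      by (intro sum.cong) auto
    then show ?thesis using assms v by simp
  qed
  from restr[OF this] have "S \<noteq> {}" by blast
  obtain f where f: "f \<in> S" "\<And>g. g \<in> S \<Longrightarrow> qform V E g \<le> qform V E f"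
    using continuous_attains_sup[OF cS \<open>S \<noteq> {}\<close> cQ] by auto
  have "qform V E g \<le> qform V E f * ?N g" for g
  proof (cases "\<forall>v\<in>V. g v = 0")
    case True
    then show ?thesis by (simp add: qform_def)
  next
    case False
    then obtain w where "w \<in> V" "g w \<noteq> 0" by blast
    then have pos: "?N g > 0" using assms by (intro sum_squares_pos)
    define c where "c = 1 / sqrt (?N g)"
    have c2: "c\<^sup>2 * ?N g = 1"
      using pos by (simp add: c_def power_divide)
    have "?N (\<lambda>v. c * g v) = 1"
      using c2 by (simp add: power_mult_distrib sum_distrib_left)
    from f(2)[OF restr[OF this]]
    have "qform V E (\<lambda>v. if v \<in> V then c * g v else 0) \<le> qform V E f" .
    moreover have "qform V E (\<lambda>v. if v \<in> V then c * g v else 0) = qform V E (\<lambda>v. c * g v)"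
      unfolding qform_def by (intro sum.cong) auto
    ultimately have "qform V E (\<lambda>v. c * g v) \<le> qform V E f" by simp
    then have "c\<^sup>2 * qform V E g \<le> qform V E f"
      by (simp add: qform_scale)
    then have "c\<^sup>2 * qform V E g * ?N g \<le> qform V E f * ?N g"
      using pos by (intro mult_right_mono) auto
    moreover have "c\<^sup>2 * qform V E g * ?N g = qform V E g * (c\<^sup>2 * ?N g)"
      by (simp only: mult_ac)
    with c2 have "c\<^sup>2 * qform V E g * ?N g = qform V E g" by simp
    ultimately show ?thesis by simp
  qed
  moreover have "?N f = 1" using f(1) by (simp add: S_def)
  ultimately show thesis by (intro that)
qed

text \<open>Near 0 the linear term dominates the quadratic one, so a non-zero linear coefficient
  would produce positive values.\<close>

lemma linear_coeff_zero:
  fixes c d :: real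
  assumes "\<And>t. 2 * t * c + t\<^sup>2 * d \<le> 0"
  shows "c = 0"
proof (rule ccontr)
  assume "c \<noteq> 0"
  \<comment> \<open>\<open>m\<close> is small enough to make \<open>2 + m * d\<close> positive; the
    contradiction comes from \<open>t = m * c\<close>.\<close>
  define m where "m = 1 / (\<bar>d\<bar> + 1)"
  have m: "m > 0" "m * \<bar>d\<bar> < 1"
    by (simp_all add: m_def)
  have "m * d \<ge> - (m * \<bar>d\<bar>)"
    using mult_left_mono[of "- \<bar>d\<bar>" d m] m(1) by simp
  with m have "m * c\<^sup>2 * (2 + m * d) > 0"
    using \<open>c \<noteq> 0\<close> by (intro mult_pos_pos) auto
  moreover have "2 * (m * c) * c + (m * c)\<^sup>2 * d = m * c\<^sup>2 * (2 + m * d)"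
    by (simp add: power2_eq_square algebra_simps)
  ultimately show False using assms[of "m * c"] by simp
qed

text \<open>First variation: \<open>f\<close> is perturbed by \<open>t\<close> times the indicator
  of \<open>v\<close>. The form minus its upper bound is then a polynomial in \<open>t\<close>
  without constant term, and its linear coefficient is the defect of the eigenvalue equation at
  \<open>v\<close>.\<close>

lemma maximiser_eigenvector:
  assumes fin: "finite V"
    and max: "\<And>g. qform V E g \<le> r * (\<Sum>v\<in>V. (g v)\<^sup>2)"
    and eq: "qform V E f = r * (\<Sum>v\<in>V. (f v)\<^sup>2)"
    and v: "v \<in> V"
  shows "(\<Sum>u\<in>V. adj E v u * f u) = r * f v"
proof -
  let ?d = "\<lambda>w. of_bool (w = v) :: real"
  let ?s = "\<Sum>u\<in>V. adj E v u * f u"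
  have delta: "(\<Sum>w\<in>V. ?d w * h w) = h v" for h :: "'a \<Rightarrow> real"
  proof -
    have "(\<Sum>w\<in>V. ?d w * h w) = (\<Sum>w\<in>V. if w = v then h w else 0)"
      by (intro sum.cong) auto
    then show ?thesis using fin v by simp
  qed
  have "2 * t * (?s - r * f v) + t\<^sup>2 * (adj E v v - r) \<le> 0" for t
  proof -
    have "qform V E (\<lambda>w. f w + t * ?d w)
        = qform V E f + t * (\<Sum>w\<in>V. ?d w * (\<Sum>u\<in>V. adj E w u * f u))
          + t * (\<Sum>w\<in>V. \<Sum>u\<in>V. ?d u * (adj E w u * f w))
          + t\<^sup>2 * (\<Sum>w\<in>V. ?d w * (\<Sum>u\<in>V. ?d u * adj E w u))"
      unfolding qform_def sum_distrib_left sum.distrib[symmetric]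
      by (intro sum.cong refl) (simp add: algebra_simps power2_eq_square)
    also have "(\<Sum>w\<in>V. \<Sum>u\<in>V. ?d u * (adj E w u * f w)) = ?s"
      by (simp only: delta) (simp add: adj_sym)
    finally have Q: "qform V E (\<lambda>w. f w + t * ?d w) = qform V E f + 2 * t * ?s + t\<^sup>2 * adj E v v"
      by (simp only: delta)
    have "(\<Sum>w\<in>V. (f w + t * ?d w)\<^sup>2)
        = (\<Sum>w\<in>V. (f w)\<^sup>2) + 2 * t * (\<Sum>w\<in>V. ?d w * f w) + t\<^sup>2 * (\<Sum>w\<in>V. ?d w * 1)"
      unfolding sum_distrib_left sum.distrib[symmetric]
      by (intro sum.cong refl) (simp add: algebra_simps power2_eq_square)
    then have "(\<Sum>w\<in>V. (f w + t * ?d w)\<^sup>2) = (\<Sum>w\<in>V. (f w)\<^sup>2) + 2 * t * f v + t\<^sup>2"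
      by (simp only: delta)
    with Q max[of "\<lambda>w. f w + t * ?d w"] eq show ?thesis
      by (simp add: algebra_simps)
  qed
  from linear_coeff_zero[OF this] show ?thesis by simp
qed

section \<open>Eigenvalues of the adjacency matrix and the Rayleigh principle\<close>

lemma vertex_list:
  assumes "finite V"
  shows "distinct (vertex_list V)" "set (vertex_list V) = V"
proof -
  have "distinct (vertex_list V) \<and> set (vertex_list V) = V"
    unfolding vertex_list_def by (rule someI_ex) (use finite_distinct_list[OF assms] in blast)
  then show "distinct (vertex_list V)" "set (vertex_list V) = V" by auto
qed

lemma sum_vertex_list:
  assumes "finite V"
  shows "(\<Sum>j<length (vertex_list V). h (vertex_list V ! j)) = (\<Sum>u\<in>V. h u)"
proof -
  have "bij_betw (\<lambda>j. vertex_list V ! j) {..<length (vertex_list V)} V"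
    using vertex_list[OF assms] by (intro bij_betw_nth) auto
  from sum.reindex_bij_betw[OF this, of h] show ?thesis .
qed

lemma eigenvalue_adj_matrix_iff:
  assumes fin: "finite V"
  shows "eigenvalue (adj_matrix V E) r \<longleftrightarrow> (\<exists>f. eigenfun V E r f)"
proof -
  define vs where "vs = vertex_list V"
  define L where "L = length vs"
  note vl = vertex_list[OF fin, folded vs_def]
  have A: "adj_matrix V E = mat L L (\<lambda>(i, j). adj E (vs ! i) (vs ! j))"
    by (auto simp: adj_matrix_def Let_def vs_def L_def adj_def)
  have mv: "vec_index (mat L L (\<lambda>(i, j). adj E (vs ! i) (vs ! j)) *\<^sub>v w) i
      = (\<Sum>j<L. adj E (vs ! i) (vs ! j) * vec_index w j)"
    if "i < L" "w \<in> carrier_vec L" for i w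
    using that by (simp add: scalar_prod_def lessThan_atLeast0)
  show ?thesis
  proof
    assume "eigenvalue (adj_matrix V E) r"
    then obtain w where w: "w \<in> carrier_vec L" "w \<noteq> 0\<^sub>v L"
      "mat L L (\<lambda>(i, j). adj E (vs ! i) (vs ! j)) *\<^sub>v w = r \<cdot>\<^sub>v w"
      by (auto simp: eigenvalue_def eigenvector_def A)
    define g where "g = the_inv_into {..<L} (\<lambda>i. vs ! i)"
    have bij: "bij_betw (\<lambda>i. vs ! i) {..<L} V"
      using vl by (intro bij_betw_nth) (auto simp: L_def)
    have g: "g (vs ! i) = i" if "i < L" for i
      unfolding g_def using bij that by (intro the_inv_into_f_f) (auto simp: bij_betw_def)
    have "eigenfun V E r (\<lambda>v. vec_index w (g v))"
      unfolding eigenfun_def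
    proof (intro conjI ballI)
      obtain i where "i < L" "vec_index w i \<noteq> 0"
        using w(1,2) by (auto simp: vec_eq_iff)
      then show "\<exists>v\<in>V. vec_index w (g v) \<noteq> 0"
        using bij by (intro bexI[of _ "vs ! i"]) (auto simp: g bij_betw_def)
      fix v assume "v \<in> V"
      then obtain i where i: "i < L" "v = vs ! i"
        using bij by (auto simp: bij_betw_def)
      have "(\<Sum>u\<in>V. adj E v u * vec_index w (g u)) = (\<Sum>j<L. adj E v (vs ! j) * vec_index w (g (vs ! j)))"
        unfolding L_def vs_def by (rule sum_vertex_list[OF fin, symmetric])
      also have "\<dots> = (\<Sum>j<L. adj E (vs ! i) (vs ! j) * vec_index w j)"
        by (intro sum.cong) (auto simp: g i)
      also have "\<dots> = r * vec_index w i"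
        using mv[OF i(1) w(1)] w(1) i(1) by (simp add: w(3))
      finally show "(\<Sum>u\<in>V. adj E v u * vec_index w (g u)) = r * vec_index w (g v)"
        by (simp add: g i)
    qed
    then show "\<exists>f. eigenfun V E r f" by blast
  next
    assume "\<exists>f. eigenfun V E r f"
    then obtain f where f: "eigenfun V E r f" ..
    define w where "w = vec L (\<lambda>i. f (vs ! i))"
    have w: "w \<in> carrier_vec L" by (simp add: w_def)
    obtain v where v: "v \<in> V" "f v \<noteq> 0" using f by (auto simp: eigenfun_def)
    then obtain i where i: "i < L" "vs ! i = v"
      using vl by (metis L_def in_set_conv_nth)
    have "vec_index w i \<noteq> vec_index (0\<^sub>v L) i"
      using i v by (simp add: w_def)
    then have "w \<noteq> 0\<^sub>v L" by metis
    moreover have "mat L L (\<lambda>(i, j). adj E (vs ! i) (vs ! j)) *\<^sub>v w = r \<cdot>\<^sub>v w"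
    proof (rule eq_vecI)
      fix j assume "j < dim_vec (r \<cdot>\<^sub>v w)"
      then have j: "j < L" by (simp add: w_def)
      have "vec_index (mat L L (\<lambda>(i, j). adj E (vs ! i) (vs ! j)) *\<^sub>v w) j
          = (\<Sum>l<L. adj E (vs ! j) (vs ! l) * f (vs ! l))"
        unfolding mv[OF j w] by (intro sum.cong) (auto simp: w_def)
      also have "\<dots> = (\<Sum>u\<in>V. adj E (vs ! j) u * f u)"
        unfolding L_def vs_def by (rule sum_vertex_list[OF fin])
      also have "\<dots> = r * f (vs ! j)"
        using f j vl by (auto simp: eigenfun_def L_def)
      finally show "vec_index (mat L L (\<lambda>(i, j). adj E (vs ! i) (vs ! j)) *\<^sub>v w) j = vec_index (r \<cdot>\<^sub>v w) j"
        using j by (simp add: w_def)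
    qed (simp add: w_def)
    ultimately show "eigenvalue (adj_matrix V E) r"
      using w by (auto simp: eigenvalue_def eigenvector_def A)
  qed
qed

text \<open>The characteristic polynomial is monic, hence non-zero, and has finitely many roots.
  This is what makes the \<open>Max\<close> in \<open>spec_rad\<close> meaningful.\<close>

lemma finite_eigenvalues_adj_matrix: "finite {r. eigenvalue (adj_matrix V E) r}"
proof -
  have A: "adj_matrix V E \<in> carrier_mat (length (vertex_list V)) (length (vertex_list V))"
    by (simp add: adj_matrix_def Let_def)
  have "char_poly (adj_matrix V E) \<noteq> 0"
    using degree_monic_char_poly[OF A] by auto
  then show ?thesis
    using poly_roots_finite eigenvalue_root_char_poly[OF A] by simp
qed

text \<open>Adjacency entries are nonnegative, so replacing a maximiser by its absolute value does
  not lower the form; the result is a nonnegative eigenvector for the maximum \<open>r\<close>. Any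
  other eigenvalue is the Rayleigh quotient of its eigenvector, hence at most
  \<open>r\<close>.\<close>

theorem spec_rad_Rayleigh:
  assumes "finite V" "V \<noteq> {}"
  shows "qform V E g \<le> spec_rad V E * (\<Sum>v\<in>V. (g v)\<^sup>2)"
    and "\<exists>f. eigenfun V E (spec_rad V E) f \<and> (\<forall>v. f v \<ge> 0)"
proof -
  obtain f where f: "(\<Sum>v\<in>V. (f v)\<^sup>2) = 1"
    and max: "\<And>g. qform V E g \<le> qform V E f * (\<Sum>v\<in>V. (g v)\<^sup>2)"
    by (rule qform_attains_max[OF assms, where E = E]) blast
  define r where "r = qform V E f"
  have absf: "(\<Sum>v\<in>V. \<bar>f v\<bar>\<^sup>2) = 1" using f by simp
  have "r \<le> qform V E (\<lambda>v. \<bar>f v\<bar>)"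
    unfolding r_def qform_def
  proof (intro sum_mono)
    fix v u
    have "f v * f u \<le> \<bar>f v\<bar> * \<bar>f u\<bar>" by (metis abs_ge_self abs_mult)
    then show "adj E v u * f v * f u \<le> adj E v u * \<bar>f v\<bar> * \<bar>f u\<bar>"
      by (simp add: mult.assoc mult_left_mono adj_nonneg)
  qed
  then have "qform V E (\<lambda>v. \<bar>f v\<bar>) = r * (\<Sum>v\<in>V. \<bar>f v\<bar>\<^sup>2)"
    using max[of "\<lambda>v. \<bar>f v\<bar>"] absf by (simp add: r_def)
  from maximiser_eigenvector[OF assms(1) max[folded r_def] this]
  have "\<forall>v\<in>V. (\<Sum>u\<in>V. adj E v u * \<bar>f u\<bar>) = r * \<bar>f v\<bar>" by blast
  moreover have "\<exists>v\<in>V. f v \<noteq> 0"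
    by (rule ccontr) (use f in simp)
  ultimately have ef: "eigenfun V E r (\<lambda>v. \<bar>f v\<bar>)"
    by (auto simp: eigenfun_def)
  have "s \<le> r" if ev: "eigenfun V E s g" for s g
  proof -
    obtain v where "v \<in> V" "g v \<noteq> 0" using ev by (auto simp: eigenfun_def)
    then have "(\<Sum>v\<in>V. (g v)\<^sup>2) > 0" using assms by (intro sum_squares_pos)
    with max[of g] qform_eigenfun[OF ev] show ?thesis by (simp add: r_def)
  qed
  then have sr: "spec_rad V E = r"
    unfolding spec_rad_def eigenvalue_adj_matrix_iff[OF assms(1)]
    using ef finite_eigenvalues_adj_matrix[of V E, unfolded eigenvalue_adj_matrix_iff[OF assms(1)]]
    by (intro Max_eqI) auto
  show "qform V E g \<le> spec_rad V E * (\<Sum>v\<in>V. (g v)\<^sup>2)"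
    unfolding sr r_def by (rule max)
  show "\<exists>f. eigenfun V E (spec_rad V E) f \<and> (\<forall>v. f v \<ge> 0)"
    unfolding sr using ef by (intro exI[of _ "\<lambda>v. \<bar>f v\<bar>"]) simp
qed

section \<open>Hamiltonian cycles in balanced bipartite graphs\<close>

text \<open>The cycle visits \<open>\<sigma> 0, \<tau> 0, \<sigma> 1, \<tau> 1, ...\<close> and
  closes from \<open>\<tau> (card X - 1)\<close> to \<open>\<sigma> 0\<close>. Since
  \<open>R\<close> relates two separate sides, one name may label a vertex on each of them.\<close>

definition ham_cyc :: "'a set \<Rightarrow> 'b set \<Rightarrow> ('a \<Rightarrow> 'b \<Rightarrow> bool) \<Rightarrow> bool" where
  "ham_cyc X Z R \<longleftrightarrow> (\<exists>\<sigma> \<tau>. bij_betw \<sigma> {..<card X} X \<and> bij_betw \<tau> {..<card X} Z \<and>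
     (\<forall>i<card X. R (\<sigma> i) (\<tau> i) \<and> R (\<sigma> (Suc i mod card X)) (\<tau> i)))"

lemma ham_cycI:
  assumes "bij_betw \<sigma> {..<card X} X" "bij_betw \<tau> {..<card X} Z"
    and "\<And>i. i < card X \<Longrightarrow> R (\<sigma> i) (\<tau> i)"
    and "\<And>i. Suc i < card X \<Longrightarrow> R (\<sigma> (Suc i)) (\<tau> i)"
    and "R (\<sigma> 0) (\<tau> (card X - 1))"
  shows "ham_cyc X Z R"
proof -
  have "R (\<sigma> (Suc i mod card X)) (\<tau> i)" if "i < card X" for i
  proof (cases "Suc i < card X")
    case False
    then have "Suc i = card X" using that by simp
    then show ?thesis using assms(5) by (metis diff_Suc_1 mod_self)
  qed (use assms(4) in simp)
  then show ?thesis unfolding ham_cyc_def using assms(1-3) by blast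
qed

lemma ham_cyc_complete:
  assumes "finite X" "finite Z" "card X = card Z" "\<And>x z. x \<in> X \<Longrightarrow> z \<in> Z \<Longrightarrow> R x z"
  shows "ham_cyc X Z R"
proof -
  obtain \<sigma> where s: "bij_betw \<sigma> {..<card X} X"
    using ex_bij_betw_nat_finite[OF assms(1)] by (auto simp: lessThan_atLeast0)
  obtain \<tau> where t: "bij_betw \<tau> {..<card X} Z"
    using ex_bij_betw_nat_finite[OF assms(2)] assms(3) by (auto simp: lessThan_atLeast0)
  show ?thesis
    unfolding ham_cyc_def
  proof (intro exI[of _ \<sigma>] exI[of _ \<tau>] conjI allI impI)
    show "bij_betw \<sigma> {..<card X} X" "bij_betw \<tau> {..<card X} Z" by (fact s t)+
    fix i assume i: "i < card X"
    then have "Suc i mod card X < card X" by simp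
    then show "R (\<sigma> i) (\<tau> i)" "R (\<sigma> (Suc i mod card X)) (\<tau> i)"
      using i bij_betwE[OF s] bij_betwE[OF t] assms(4) by simp_all
  qed
qed

lemma bij_betw_lessThanI:
  fixes \<pi> :: "nat \<Rightarrow> nat"
  assumes "inj_on \<pi> {..<N}" "\<And>j. j < N \<Longrightarrow> \<pi> j < N"
  shows "bij_betw \<pi> {..<N} {..<N}"
proof -
  have "\<pi> ` {..<N} \<subseteq> {..<N}" using assms(2) by auto
  from endo_inj_surj[OF _ this assms(1)] show ?thesis
    using assms(1) by (simp add: bij_betw_def)
qed

lemma bij_betw_rotate:
  fixes N c :: nat
  shows "bij_betw (\<lambda>j. (c + j) mod N) {..<N} {..<N}"
proof (rule bij_betw_lessThanI)
  show "inj_on (\<lambda>j. (c + j) mod N) {..<N}"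
  proof (rule inj_onI)
    fix j l assume "j \<in> {..<N}" "l \<in> {..<N}" "(c + j) mod N = (c + l) mod N"
    then obtain q q' where "j + N * q = l + N * q'" "j < N" "l < N"
      by (auto simp: nat_mod_eq_iff)
    then show "j = l" by (metis mod_less mod_mult_self2)
  qed
qed auto

text \<open>The classical crossing argument: a path whose ends have large degree sum can be
  closed up to a cycle through the same vertices.\<close>

lemma ham_path_close:
  fixes X :: "'a set" and Z :: "'b set"
  assumes s: "bij_betw \<sigma> {..<card X} X" and t: "bij_betw \<tau> {..<card X} Z"
    and R1: "\<And>i. i < card X \<Longrightarrow> R (\<sigma> i) (\<tau> i)"
    and R2: "\<And>i. Suc i < card X \<Longrightarrow> R (\<sigma> (Suc i)) (\<tau> i)"
    and deg: "card {z\<in>Z. R (\<sigma> 0) z} + card {x\<in>X. R x (\<tau> (card X - 1))} > card X"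
  shows "ham_cyc X Z R"
proof -
  define N where "N = card X"
  \<comment> \<open>\<open>I\<close> and \<open>J\<close> index the neighbours of the two ends of
    the path. Their sizes exceed \<open>N\<close> in total, so they share an index \<open>i\<close>,
    which gives two crossing chords.\<close>
  define I where "I = {i\<in>{..<N}. R (\<sigma> 0) (\<tau> i)}"
  define J where "J = {i\<in>{..<N}. R (\<sigma> i) (\<tau> (N - 1))}"
  have "bij_betw \<tau> I {z\<in>Z. R (\<sigma> 0) z}"
    using t unfolding I_def N_def by (auto simp: bij_betw_def inj_on_def)
  moreover have "bij_betw \<sigma> J {x\<in>X. R x (\<tau> (N - 1))}"
    using s unfolding J_def N_def by (auto simp: bij_betw_def inj_on_def)
  ultimately have "card I + card J > N"
    using deg by (simp add: bij_betw_same_card N_def)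
  moreover have "card (I \<union> J) \<le> N"
    using card_mono[of "{..<N}" "I \<union> J"] by (auto simp: I_def J_def)
  ultimately have "card (I \<inter> J) > 0"
    using card_Un_Int[of I J] by (simp add: I_def J_def)
  then obtain i where i: "i < N" "R (\<sigma> 0) (\<tau> i)" "R (\<sigma> i) (\<tau> (N - 1))"
    by (auto simp: card_gt_0_iff I_def J_def)
  \<comment> \<open>The new cycle follows the path to \<open>\<sigma> i\<close>, jumps to
    \<open>\<tau> (N - 1)\<close>, walks back to \<open>\<tau> i\<close> and returns to
    \<open>\<sigma> 0\<close>.\<close>
  define \<pi> where "\<pi> j = (if j \<le> i then j else N + i - j)" for j
  define \<pi>' where "\<pi>' j = (if j < i then j else N - 1 + i - j)" for j
  have b: "bij_betw \<pi> {..<N} {..<N}" "bij_betw \<pi>' {..<N} {..<N}"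
    using i(1) by (auto intro!: bij_betw_lessThanI inj_onI simp: \<pi>_def \<pi>'_def split: if_splits)
  show ?thesis
  proof (rule ham_cycI)
    show "bij_betw (\<sigma> \<circ> \<pi>) {..<card X} X" "bij_betw (\<tau> \<circ> \<pi>') {..<card X} Z"
      using bij_betw_trans[OF b(1) s[folded N_def]] bij_betw_trans[OF b(2) t[folded N_def]]
      by (simp_all add: N_def)
    show "R ((\<sigma> \<circ> \<pi>) 0) ((\<tau> \<circ> \<pi>') (card X - 1))"
      using i by (auto simp: \<pi>_def \<pi>'_def N_def[symmetric])
    fix j
    show "R ((\<sigma> \<circ> \<pi>) j) ((\<tau> \<circ> \<pi>') j)" if j: "j < card X"
    proof (cases "j \<le> i")
      case True
      then show ?thesis using i j R1[of j] by (cases "j = i") (auto simp: \<pi>_def \<pi>'_def N_def)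
    next
      case False
      then have "\<pi> j = Suc (N - 1 + i - j)" "\<pi>' j = N - 1 + i - j" "Suc (N - 1 + i - j) < N"
        using j by (auto simp: N_def \<pi>_def \<pi>'_def)
      then show ?thesis using R2[of "N - 1 + i - j"] by (simp only: o_apply N_def)
    qed
    show "R ((\<sigma> \<circ> \<pi>) (Suc j)) ((\<tau> \<circ> \<pi>') j)" if j: "Suc j < card X"
    proof (cases "j < i")
      case True
      then show ?thesis using j R2[of j] by (auto simp: \<pi>_def \<pi>'_def N_def)
    next
      case False
      then have "\<pi> (Suc j) = N - 1 + i - j" "\<pi>' j = N - 1 + i - j" "N - 1 + i - j < N"
        using j i(1) by (auto simp: N_def \<pi>_def \<pi>'_def)
      then show ?thesis using R1[of "N - 1 + i - j"] by (simp only: o_apply N_def)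
    qed
  qed
qed

text \<open>Rotating, and possibly reversing, the cycle makes the new edge its closing edge.\<close>

lemma ham_cyc_add_edge:
  fixes X :: "'a set" and Z :: "'b set"
  assumes N: "card X \<ge> 2" and cyc: "ham_cyc X Z (\<lambda>a c. R a c \<or> a = x \<and> c = z)"
    and non: "\<not> ham_cyc X Z R"
  shows "card {c\<in>Z. R x c} + card {a\<in>X. R a z} \<le> card X"
proof (rule ccontr)
  assume deg: "\<not> ?thesis"
  let ?R = "\<lambda>a c. R a c \<or> a = x \<and> c = z"
  define N where "N = card X"
  have N2: "N \<ge> 2" using N by (simp add: N_def)
  obtain \<sigma> \<tau> where st: "bij_betw \<sigma> {..<N} X" "bij_betw \<tau> {..<N} Z"
    and R: "\<And>i. i < N \<Longrightarrow> ?R (\<sigma> i) (\<tau> i)" "\<And>i. i < N \<Longrightarrow> ?R (\<sigma> (Suc i mod N)) (\<tau> i)"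
    using cyc unfolding ham_cyc_def N_def[symmetric] by blast
  \<comment> \<open>If a re-indexing makes the cycle start in \<open>x\<close> and end in
    \<open>z\<close>, the new pair occurs only as its closing edge. All other edges satisfy
    \<open>R\<close>, so the degree sum closes the path within \<open>R\<close>.\<close>
  have close: False
    if b: "bij_betw \<pi> {..<N} {..<N}" "bij_betw \<pi>' {..<N} {..<N}"
      and P: "\<And>i. i < N \<Longrightarrow> ?R (\<sigma> (\<pi> i)) (\<tau> (\<pi>' i))"
        "\<And>i. Suc i < N \<Longrightarrow> ?R (\<sigma> (\<pi> (Suc i))) (\<tau> (\<pi>' i))"
        "\<sigma> (\<pi> 0) = x" "\<tau> (\<pi>' (N - 1)) = z" for \<pi> \<pi>'
  proof -
    have s: "bij_betw (\<sigma> \<circ> \<pi>) {..<N} X" and t: "bij_betw (\<tau> \<circ> \<pi>') {..<N} Z"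
      using bij_betw_trans[OF b(1) st(1)] bij_betw_trans[OF b(2) st(2)] by auto
    have x: "i = 0" if "i < N" "\<sigma> (\<pi> i) = x" for i
      using inj_onD[OF bij_betw_imp_inj_on[OF s], of i 0] that P(3) by auto
    have z: "i = N - 1" if "i < N" "\<tau> (\<pi>' i) = z" for i
      using inj_onD[OF bij_betw_imp_inj_on[OF t], of i "N - 1"] that P(4) by auto
    have "ham_cyc X Z R"
    proof (rule ham_path_close[where \<sigma> = "\<sigma> \<circ> \<pi>" and \<tau> = "\<tau> \<circ> \<pi>'"])
      show "R ((\<sigma> \<circ> \<pi>) i) ((\<tau> \<circ> \<pi>') i)" if "i < card X" for i
        using P(1)[of i] x[of i] z[of i] that N2 by (auto simp: N_def)
      show "R ((\<sigma> \<circ> \<pi>) (Suc i)) ((\<tau> \<circ> \<pi>') i)" if "Suc i < card X" for i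
        using P(2)[of i] x[of "Suc i"] that by (auto simp: N_def)
    qed (use s t P(3,4) deg in \<open>auto simp: N_def\<close>)
    with non show False ..
  qed
  have "\<exists>i<N. \<not> R (\<sigma> i) (\<tau> i) \<or> \<not> R (\<sigma> (Suc i mod N)) (\<tau> i)"
    using non st unfolding ham_cyc_def N_def by blast
  then obtain i where i: "i < N" "\<not> R (\<sigma> i) (\<tau> i) \<or> \<not> R (\<sigma> (Suc i mod N)) (\<tau> i)" by blast
  have rev: "bij_betw (\<lambda>j. N - 1 - j) {..<N} {..<N}"
    by (rule bij_betw_lessThanI) (auto simp: inj_on_def)
  have rotrev: "bij_betw (\<lambda>j. (c + (N - 1 - j)) mod N) {..<N} {..<N}" for c
    using bij_betw_trans[OF rev bij_betw_rotate[of c N]] by (simp add: o_def)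
  \<comment> \<open>The new pair may be used in either orientation: as
    \<open>\<sigma> i, \<tau> i\<close>, when the cycle has to be reversed, or as
    \<open>\<tau> i\<close> and the next \<open>\<sigma>\<close>, when a rotation suffices.\<close>
  show False
  proof (cases "R (\<sigma> i) (\<tau> i)")
    case False
    then have xz: "\<sigma> i = x" "\<tau> i = z" using R(1)[OF i(1)] by auto
    have suc: "(Suc i + (N - 1 - j)) mod N = Suc ((i + (N - 1 - j)) mod N) mod N" for j
      by (simp add: mod_Suc_eq)
    have R': "?R (\<sigma> (l mod N)) (\<tau> (l mod N))" "?R (\<sigma> (Suc (l mod N) mod N)) (\<tau> (l mod N))" for l
      using R(1)[of "l mod N"] R(2)[of "l mod N"] N2 by auto
    show False
    proof (rule close[OF rotrev[of "Suc i"] rotrev[of i]])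
      fix j
      show "?R (\<sigma> ((Suc i + (N - 1 - j)) mod N)) (\<tau> ((i + (N - 1 - j)) mod N))"
        unfolding suc by (rule R'(2))
      assume "Suc j < N"
      then have "Suc i + (N - 1 - Suc j) = i + (N - 1 - j)" by simp
      then show "?R (\<sigma> ((Suc i + (N - 1 - Suc j)) mod N)) (\<tau> ((i + (N - 1 - j)) mod N))"
        using R'(1) by (simp only:)
    qed (use xz i(1) N2 in auto)
  next
    case True
    then have xz: "\<sigma> (Suc i mod N) = x" "\<tau> i = z" using R(2)[OF i(1)] i(2) by auto
    have R': "?R (\<sigma> (l mod N)) (\<tau> (l mod N))" "?R (\<sigma> (Suc (l mod N) mod N)) (\<tau> (l mod N))" for l
      using R(1)[of "l mod N"] R(2)[of "l mod N"] N2 by auto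
    show False
    proof (rule close[OF bij_betw_rotate[of "Suc i" N] bij_betw_rotate[of "Suc i" N]])
      fix j
      show "?R (\<sigma> ((Suc i + j) mod N)) (\<tau> ((Suc i + j) mod N))"
        by (rule R'(1))
      have "(Suc i + Suc j) mod N = Suc ((Suc i + j) mod N) mod N"
        by (simp add: mod_Suc_eq)
      then show "?R (\<sigma> ((Suc i + Suc j) mod N)) (\<tau> ((Suc i + j) mod N))"
        using R'(2)[of "Suc i + j"] by simp
    next
      have "Suc i + (N - 1) = i + N" using N2 by simp
      then show "\<tau> ((Suc i + (N - 1)) mod N) = z" using xz(2) i(1) by simp
    qed (use xz(1) in simp)
  qed
qed

lemma ham_cyc_mono:
  assumes "ham_cyc X Z R" "\<And>x z. x \<in> X \<Longrightarrow> z \<in> Z \<Longrightarrow> R x z \<Longrightarrow> R' x z"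
  shows "ham_cyc X Z R'"
proof -
  obtain \<sigma> \<tau> where st: "bij_betw \<sigma> {..<card X} X" "bij_betw \<tau> {..<card X} Z"
    and R: "\<forall>i<card X. R (\<sigma> i) (\<tau> i) \<and> R (\<sigma> (Suc i mod card X)) (\<tau> i)"
    using assms(1) unfolding ham_cyc_def by blast
  show ?thesis
    unfolding ham_cyc_def
  proof (intro exI[of _ \<sigma>] exI[of _ \<tau>] conjI allI impI)
    show "bij_betw \<sigma> {..<card X} X" "bij_betw \<tau> {..<card X} Z" by (fact st)+
    fix i assume i: "i < card X"
    then have "Suc i mod card X < card X" by simp
    then have "\<sigma> i \<in> X" "\<tau> i \<in> Z" "\<sigma> (Suc i mod card X) \<in> X"
      using i bij_betwE[OF st(1)] bij_betwE[OF st(2)] by simp_all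
    then show "R' (\<sigma> i) (\<tau> i)" "R' (\<sigma> (Suc i mod card X)) (\<tau> i)"
      using i R assms(2) by auto
  qed
qed

text \<open>A maximal relation is taken among the finitely many that contain \<open>R\<close> on
  \<open>X \<times> Z\<close> and have no Hamiltonian cycle. It is not complete, and adding a
  missing pair creates a cycle, so \<open>ham_cyc_add_edge\<close> applies.\<close>

lemma maximal_non_ham:
  assumes fin: "finite X" "finite Z" and card: "card X = card Z" "card X \<ge> 2"
    and non: "\<not> ham_cyc X Z R"
  obtains S where "\<And>x z. x \<in> X \<Longrightarrow> z \<in> Z \<Longrightarrow> R x z \<Longrightarrow> S x z"
    and "\<exists>x\<in>X. \<exists>z\<in>Z. \<not> S x z"
    and "\<And>x z. x \<in> X \<Longrightarrow> z \<in> Z \<Longrightarrow> \<not> S x z \<Longrightarrow>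
      card {c\<in>Z. S x c} + card {a\<in>X. S a z} \<le> card X"
proof -
  define F where "F = {T. T \<subseteq> X \<times> Z \<and> {(x, z) \<in> X \<times> Z. R x z} \<subseteq> T \<and> \<not> ham_cyc X Z (\<lambda>x z. (x, z) \<in> T)}"
  have "\<not> ham_cyc X Z (\<lambda>x z. (x, z) \<in> {(x, z) \<in> X \<times> Z. R x z})"
    using non ham_cyc_mono[of X Z _ R] by blast
  then have "{(x, z) \<in> X \<times> Z. R x z} \<in> F" by (auto simp: F_def)
  moreover have "finite F"
    by (rule finite_subset[of _ "Pow (X \<times> Z)"]) (auto simp: F_def fin)
  ultimately obtain T where T: "T \<in> F" "\<And>U. U \<in> F \<Longrightarrow> T \<subseteq> U \<Longrightarrow> U = T"
    using finite_has_maximal[of F] by blast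
  have nonT: "\<not> ham_cyc X Z (\<lambda>x z. (x, z) \<in> T)" using T(1) by (simp add: F_def)
  show thesis
  proof (rule that[of "\<lambda>x z. (x, z) \<in> T"])
    show "(x, z) \<in> T" if "x \<in> X" "z \<in> Z" "R x z" for x z
      using T(1) that by (auto simp: F_def)
    show "\<exists>x\<in>X. \<exists>z\<in>Z. (x, z) \<notin> T"
      using nonT ham_cyc_complete[OF fin card(1), of "\<lambda>x z. (x, z) \<in> T"] by blast
    fix x z assume xz: "x \<in> X" "z \<in> Z" "(x, z) \<notin> T"
    then have "insert (x, z) T \<notin> F" using T(2)[of "insert (x, z) T"] by blast
    then have "ham_cyc X Z (\<lambda>a c. (a, c) \<in> insert (x, z) T)"
      using T(1) xz unfolding F_def by blast
    moreover have "(\<lambda>a c. (a, c) \<in> insert (x, z) T) = (\<lambda>a c. (a, c) \<in> T \<or> a = x \<and> c = z)"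
      by (auto simp: fun_eq_iff)
    ultimately show "card {c\<in>Z. (x, c) \<in> T} + card {a\<in>X. (a, z) \<in> T} \<le> card X"
      using ham_cyc_add_edge[OF card(2) _ nonT, of x z] by simp
  qed
qed

section \<open>Missing pairs and the structure of non-Hamiltonian graphs\<close>

lemma card_filter_compl:
  assumes "finite A"
  shows "card {x\<in>A. P x} + card {x\<in>A. \<not> P x} = card A"
proof -
  have "{x\<in>A. P x} \<union> {x\<in>A. \<not> P x} = A" "{x\<in>A. P x} \<inter> {x\<in>A. \<not> P x} = {}" by auto
  then show ?thesis using assms card_Un_disjoint[of "{x\<in>A. P x}" "{x\<in>A. \<not> P x}"] by simp
qed

definition nonedges :: "'a set \<Rightarrow> 'b set \<Rightarrow> ('a \<Rightarrow> 'b \<Rightarrow> bool) \<Rightarrow> nat" where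
  "nonedges X Z R = card {(x, z). x \<in> X \<and> z \<in> Z \<and> \<not> R x z}"

lemma finite_nonedges:
  "finite X \<Longrightarrow> finite Z \<Longrightarrow> finite {(x, z). x \<in> X \<and> z \<in> Z \<and> \<not> R x z}"
  by (rule finite_subset[of _ "X \<times> Z"]) auto

lemma nonedges_mono:
  assumes "finite X" "finite Z" "X' \<subseteq> X" "Z' \<subseteq> Z"
    "\<And>x z. x \<in> X' \<Longrightarrow> z \<in> Z' \<Longrightarrow> R x z \<Longrightarrow> R' x z"
  shows "nonedges X' Z' R' \<le> nonedges X Z R"
  unfolding nonedges_def using assms by (intro card_mono finite_nonedges) auto

lemma nonedges_ge_left:
  assumes fin: "finite X" "finite Z" and A: "A \<subseteq> X"
    and m: "\<And>x. x \<in> A \<Longrightarrow> m \<le> card {z\<in>Z. \<not> R x z}"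
  shows "card A * m \<le> nonedges X Z R"
proof -
  have "finite A" using fin A finite_subset by blast
  have "card A * m \<le> (\<Sum>x\<in>A. card {z\<in>Z. \<not> R x z})"
    using sum_bounded_below[of A m] m by simp
  also have "\<dots> = card (SIGMA x:A. {z\<in>Z. \<not> R x z})"
    using fin \<open>finite A\<close> by (simp add: card_SigmaI)
  also have "\<dots> \<le> nonedges X Z R"
    unfolding nonedges_def using fin A by (intro card_mono finite_nonedges) auto
  finally show ?thesis .
qed

lemma nonedges_swap: "nonedges X Z R = nonedges Z X (\<lambda>z x. R x z)"
  unfolding nonedges_def
  by (rule bij_betw_same_card[of prod.swap]) (auto simp: bij_betw_def inj_on_def image_iff)

lemma nonedges_ge_right:
  assumes "finite X" "finite Z" "B \<subseteq> Z"
    and "\<And>z. z \<in> B \<Longrightarrow> m \<le> card {x\<in>X. \<not> R x z}"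
  shows "card B * m \<le> nonedges X Z R"
  unfolding nonedges_swap[of X] using assms by (intro nonedges_ge_left)

text \<open>In a maximal non-Hamiltonian supergraph take a non-adjacent pair \<open>x, z\<close> of maximal degree
  sum; then \<open>a, b\<close> are the degrees of \<open>x, z\<close>, while \<open>A, B\<close> are the non-neighbours of \<open>z, x\<close>.\<close>

theorem non_ham_structure:
  fixes X :: "'a set" and Z :: "'b set"
  assumes fin: "finite X" "finite Z" and card: "card X = N" "card Z = N" "N \<ge> 2"
    and non: "\<not> ham_cyc X Z R"
  obtains a b A B where "a + b \<le> N" "A \<subseteq> X" "B \<subseteq> Z" "A \<noteq> {}" "B \<noteq> {}"
    "card A = N - b" "card B = N - a"
    "\<And>x. x \<in> A \<Longrightarrow> card {z\<in>Z. R x z} \<le> a" "\<And>z. z \<in> B \<Longrightarrow> card {x\<in>X. R x z} \<le> b"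
    "\<And>y. a + b = N \<Longrightarrow> y \<in> B \<Longrightarrow>
       (N - a - 1) * (N - b) + (a - 1) \<le> nonedges X (Z - {y}) R \<or> (\<forall>x\<in>A. \<forall>z\<in>B. \<not> R x z)"
proof -
  obtain S where RS: "\<And>x z. x \<in> X \<Longrightarrow> z \<in> Z \<Longrightarrow> R x z \<Longrightarrow> S x z"
    and nc: "\<exists>x\<in>X. \<exists>z\<in>Z. \<not> S x z"
    and clo: "\<And>x z. x \<in> X \<Longrightarrow> z \<in> Z \<Longrightarrow> \<not> S x z \<Longrightarrow>
      card {c\<in>Z. S x c} + card {a\<in>X. S a z} \<le> N"
    using maximal_non_ham[OF fin _ _ non] card by auto
  define dx where "dx x = card {c\<in>Z. S x c}" for x
  define dz where "dz z = card {a\<in>X. S a z}" for z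
  have ndx: "card {c\<in>Z. \<not> S x c} = N - dx x" for x
    using card_filter_compl[OF fin(2), of "S x"] card by (simp add: dx_def)
  have ndz: "card {a\<in>X. \<not> S a z} = N - dz z" for z
    using card_filter_compl[OF fin(1), of "\<lambda>a. S a z"] card by (simp add: dz_def)
  note clo = clo[folded dx_def dz_def]
  define P where "P = {(x, z). x \<in> X \<and> z \<in> Z \<and> \<not> S x z}"
  have "finite P" "P \<noteq> {}" using fin nc by (auto simp: P_def finite_nonedges)
  define g where "g w = dx (fst w) + dz (snd w)" for w
  have "Max (g ` P) \<in> g ` P"
    using \<open>finite P\<close> \<open>P \<noteq> {}\<close> by (intro Max_in) auto
  then obtain w where w: "w \<in> P" "g w = Max (g ` P)" by auto
  have max: "g w' \<le> g w" if "w' \<in> P" for w'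
    using \<open>finite P\<close> that w(2) by simp
  obtain x z where xz: "x \<in> X" "z \<in> Z" "\<not> S x z" "w = (x, z)"
    using w(1) by (auto simp: P_def)
  define A where "A = {a\<in>X. \<not> S a z}"
  define B where "B = {c\<in>Z. \<not> S x c}"
  \<comment> \<open>Exchanging \<open>x\<close> for another non-neighbour \<open>x'\<close> of
    \<open>z\<close> keeps the pair non-adjacent, so maximality of the degree sum bounds
    \<open>dx x'\<close>; the same holds for \<open>z\<close> below.\<close>
  have dA: "dx x' \<le> dx x" if "x' \<in> A" for x'
    using max[of "(x', z)"] that xz by (auto simp: A_def P_def g_def)
  have dB: "dz z' \<le> dz z" if "z' \<in> B" for z'
    using max[of "(x, z')"] that xz by (auto simp: B_def P_def g_def)
  have finB: "finite B" using fin by (simp add: B_def)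
  show thesis
  proof (rule that[of "dx x" "dz z" A B])
    show "dx x + dz z \<le> N" using clo xz by auto
    show "A \<subseteq> X" "B \<subseteq> Z" "A \<noteq> {}" "B \<noteq> {}" using xz by (auto simp: A_def B_def)
    show cA: "card A = N - dz z" and cB: "card B = N - dx x"
      by (simp_all add: A_def B_def ndx ndz)
    show "card {z\<in>Z. R x' z} \<le> dx x" if "x' \<in> A" for x'
    proof -
      have "card {z\<in>Z. R x' z} \<le> dx x'"
        unfolding dx_def using RS that fin by (intro card_mono) (auto simp: A_def)
      then show ?thesis using dA[OF that] by simp
    qed
    show "card {x\<in>X. R x z'} \<le> dz z" if "z' \<in> B" for z'
    proof -
      have "card {x\<in>X. R x z'} \<le> dz z'"
        unfolding dz_def using RS that fin by (intro card_mono) (auto simp: B_def)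
      then show ?thesis using dB[OF that] by simp
    qed
    \<comment> \<open>\<open>y\<close> is disregarded when missing pairs are counted; it will be the
      artificial vertex of the path problem.\<close>
    fix y assume sum: "dx x + dz z = N" and y: "y \<in> B"
    have le: "nonedges X (Z - {y}) S \<le> nonedges X (Z - {y}) R"
      using fin RS by (intro nonedges_mono) auto
    show "(N - dx x - 1) * (N - dz z) + (dx x - 1) \<le> nonedges X (Z - {y}) R \<or> (\<forall>x\<in>A. \<forall>z\<in>B. \<not> R x z)"
    proof (cases "\<exists>x'\<in>A. \<exists>c\<in>Z - B. \<not> S x' c")
      case True
      then obtain x' c where x': "x' \<in> A" and c: "c \<in> Z" "c \<notin> B" "\<not> S x' c" by blast
      have x'X: "x' \<in> X" using x' by (simp add: A_def)
      \<comment> \<open>Three disjoint families of missing pairs avoiding \<open>y\<close>: those at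
        \<open>B - {y}\<close>, those at \<open>c\<close>, and those at \<open>x'\<close> with the
        other end outside \<open>B\<close> and different from \<open>c\<close>.\<close>
      define P1 where "P1 = {(a, e). a \<in> X \<and> e \<in> B - {y} \<and> \<not> S a e}"
      define P2 where "P2 = {a\<in>X. \<not> S a c} \<times> {c}"
      define P3 where "P3 = {x'} \<times> ({e\<in>Z. \<not> S x' e} - B - {c})"
      have fin': "finite P1" "finite P2" "finite P3"
        using fin finB finite_nonedges[of X "B - {y}" S] by (auto simp: P1_def P2_def P3_def)
      have "card (P1 \<union> P2 \<union> P3) \<le> nonedges X (Z - {y}) S"
        unfolding nonedges_def using fin x'X c y
        by (intro card_mono finite_nonedges) (auto simp: P1_def P2_def P3_def B_def)
      moreover have "card (P1 \<union> P2 \<union> P3) = card P1 + card P2 + card P3"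
        using fin' c by (subst card_Un_disjoint; (subst card_Un_disjoint)?)
          (auto simp: P1_def P2_def P3_def)
      moreover have P1: "card (B - {y}) * (N - dz z) \<le> card P1"
      proof -
        have "N - dz z \<le> card {a\<in>X. \<not> S a e}" if "e \<in> B - {y}" for e
          using dB[of e] that by (simp add: ndz)
        then show ?thesis
          unfolding P1_def nonedges_def[symmetric] using fin finB
          by (intro nonedges_ge_right) auto
      qed
      have "(N - dx x - 1) * (N - dz z) \<le> card P1"
        using P1 y finB cB by simp
      moreover have "card P2 = N - dz c"
        by (simp add: P2_def card_cartesian_product ndz)
      moreover have "card P3 \<ge> N - dx x' - card B - 1"
      proof -
        have "card ({e\<in>Z. \<not> S x' e} - B) \<ge> N - dx x' - card B"
          using diff_card_le_card_Diff[OF finB, of "{e\<in>Z. \<not> S x' e}"] by (simp add: ndx)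
        moreover have "card ({e\<in>Z. \<not> S x' e} - B - {c}) \<ge> card ({e\<in>Z. \<not> S x' e} - B) - 1"
          using diff_card_le_card_Diff[of "{c}" "{e\<in>Z. \<not> S x' e} - B"] by simp
        ultimately show ?thesis by (simp add: P3_def card_cartesian_product)
      qed
      moreover have "dx x' + dz c \<le> N" using clo[OF x'X c(1,3)] .
      \<comment> \<open>By the degree-sum bound \<open>c\<close> misses at least
        \<open>dx x'\<close> vertices, and \<open>x'\<close> misses at least
        \<open>dx x - dx x' - 1\<close> further ones.\<close>
      moreover have "dx x - 1 \<le> m + m'"
        if "m = N - dz c" "N - dx x' - (N - dx x) - 1 \<le> m'" "dx x' + dz c \<le> N" for m m'
        using that sum by linarith
      ultimately have "(N - dx x - 1) * (N - dz z) + (dx x - 1) \<le> nonedges X (Z - {y}) S"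
        unfolding cB by (smt (verit, best) add.assoc add_mono le_trans)
      then show ?thesis using le by simp
    next
      case False
      \<comment> \<open>The non-neighbours of \<open>x'\<close> lie in \<open>B\<close>, and by
        \<open>dA\<close> there are at least \<open>card B\<close> of them, so they are exactly
        \<open>B\<close>.\<close>
      have "\<not> S x' e" if x': "x' \<in> A" and e: "e \<in> B" for x' e
      proof -
        have "{e\<in>Z. \<not> S x' e} \<subseteq> B" using False x' by blast
        moreover have "card B \<le> card {e\<in>Z. \<not> S x' e}"
          using dA[OF x'] by (simp add: ndx cB)
        ultimately have "{e\<in>Z. \<not> S x' e} = B"
          using finB by (intro card_seteq)
        then show ?thesis using e by blast
      qed
      then have "\<forall>x\<in>A. \<forall>z\<in>B. \<not> R x z"
        using RS by (auto simp: A_def B_def)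
      then show ?thesis ..
    qed
  qed
qed

section \<open>From Hamiltonian cycles to Hamiltonian paths\<close>

lemma ham_path_sym:
  assumes "ham_path V E u v"
  shows "ham_path V E v u"
proof -
  obtain ps where ps: "distinct ps" "set ps = V" "ps \<noteq> []" "hd ps = u" "last ps = v"
    "\<And>i. Suc i < length ps \<Longrightarrow> {ps ! i, ps ! Suc i} \<in> E"
    using assms unfolding ham_path_def by blast
  show ?thesis
    unfolding ham_path_def
  proof (intro exI[of _ "rev ps"] conjI allI impI)
    fix i assume i: "Suc i < length (rev ps)"
    define j where "j = length ps - Suc (Suc i)"
    have "rev ps ! i = ps ! Suc j" "rev ps ! Suc i = ps ! j" "Suc j < length ps"
      using i by (simp_all add: rev_nth j_def Suc_diff_Suc)
    then show "{rev ps ! i, rev ps ! Suc i} \<in> E"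
      using ps(6)[of j] by (simp add: insert_commute)
  qed (use ps in \<open>auto simp: hd_rev last_rev\<close>)
qed

text \<open>With a chosen vertex of \<open>Z\<close> in the last position, deleting it opens the
  cycle into a path with both ends in \<open>X\<close>.\<close>

lemma ham_cyc_rotate:
  assumes "ham_cyc X Z R" "z \<in> Z"
  obtains \<sigma> \<tau> where "bij_betw \<sigma> {..<card X} X" "bij_betw \<tau> {..<card X} Z"
    "\<And>i. i < card X \<Longrightarrow> R (\<sigma> i) (\<tau> i)" "\<And>i. Suc i < card X \<Longrightarrow> R (\<sigma> (Suc i)) (\<tau> i)"
    "R (\<sigma> 0) (\<tau> (card X - 1))" "\<tau> (card X - 1) = z"
proof -
  define N where "N = card X"
  obtain \<sigma> \<tau> where st: "bij_betw \<sigma> {..<N} X" "bij_betw \<tau> {..<N} Z"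
    and R: "\<And>i. i < N \<Longrightarrow> R (\<sigma> i) (\<tau> i)" "\<And>i. i < N \<Longrightarrow> R (\<sigma> (Suc i mod N)) (\<tau> i)"
    using assms(1) unfolding ham_cyc_def N_def[symmetric] by blast
  obtain i where i: "i < N" "\<tau> i = z" using st(2) assms(2) by (auto simp: bij_betw_def)
  define \<pi> where "\<pi> j = (Suc i + j) mod N" for j
  have N: "N > 0" using i by simp
  have b: "bij_betw \<pi> {..<N} {..<N}" unfolding \<pi>_def by (rule bij_betw_rotate)
  have lt: "\<pi> j < N" for j using N by (simp add: \<pi>_def)
  have suc: "\<pi> (Suc j) = Suc (\<pi> j) mod N" for j by (simp add: \<pi>_def mod_Suc_eq)
  have "Suc i + (N - 1) = i + N" using N by simp
  then have last: "\<pi> (N - 1) = i" using i(1) by (simp add: \<pi>_def)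
  have first: "\<pi> 0 = Suc i mod N" by (simp add: \<pi>_def)
  show thesis
  proof (rule that[of "\<sigma> \<circ> \<pi>" "\<tau> \<circ> \<pi>"])
    show "bij_betw (\<sigma> \<circ> \<pi>) {..<card X} X" "bij_betw (\<tau> \<circ> \<pi>) {..<card X} Z"
      using bij_betw_trans[OF b st(1)] bij_betw_trans[OF b st(2)] by (simp_all add: N_def)
    show "R ((\<sigma> \<circ> \<pi>) j) ((\<tau> \<circ> \<pi>) j)" "R ((\<sigma> \<circ> \<pi>) (Suc j)) ((\<tau> \<circ> \<pi>) j)" for j
      using R[OF lt[of j]] by (simp_all add: suc)
    show "R ((\<sigma> \<circ> \<pi>) 0) ((\<tau> \<circ> \<pi>) (card X - 1))" "(\<tau> \<circ> \<pi>) (card X - 1) = z"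
      using R(2)[OF i(1)] i(2) by (simp_all add: N_def[symmetric] last[simplified] first)
  qed
qed

lemma ham_path_of_alternating:
  assumes N: "N > 0" and s: "bij_betw \<sigma> {..<N} X" and t: "bij_betw \<tau> {..<N - 1} Y" and disj: "X \<inter> Y = {}"
    and E: "\<And>i. Suc i < N \<Longrightarrow> {\<sigma> i, \<tau> i} \<in> E" "\<And>i. Suc i < N \<Longrightarrow> {\<sigma> (Suc i), \<tau> i} \<in> E"
  shows "ham_path (X \<union> Y) E (\<sigma> 0) (\<sigma> (N - 1))"
proof -
  \<comment> \<open>Even positions carry \<open>\<sigma>\<close>, odd ones \<open>\<tau>\<close>.
    With both ends in \<open>X\<close> there are \<open>N\<close> of the former and
    \<open>N - 1\<close> of the latter, hence the length \<open>2 * N - 1\<close>.\<close>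
  define h where "h j = (if even j then \<sigma> (j div 2) else \<tau> (j div 2))" for j
  define L where "L = 2 * N - 1"
  have ev: "j div 2 < N" if "j < L" for j
    using that by (auto simp: L_def)
  have od: "j div 2 < N - 1" if "j < L" "odd j" for j
    using that by (auto simp: L_def elim!: oddE)
  have hX: "h j \<in> X" if "j < L" "even j" for j
    using that ev bij_betwE[OF s] by (simp add: h_def)
  have hY: "h j \<in> Y" if "j < L" "odd j" for j
    using that od bij_betwE[OF t] by (simp add: h_def)
  have "inj_on h {..<L}"
  proof (rule inj_onI)
    fix i j assume ij: "i \<in> {..<L}" "j \<in> {..<L}" "h i = h j"
    then have par: "even i \<longleftrightarrow> even j" using hX[of i] hX[of j] hY[of i] hY[of j] disj by auto
    have "i div 2 = j div 2"
    proof (cases "even i")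
      case True
      then show ?thesis using ij par ev inj_onD[OF bij_betw_imp_inj_on[OF s], of "i div 2" "j div 2"]
        by (simp add: h_def)
    next
      case False
      then show ?thesis using ij par od inj_onD[OF bij_betw_imp_inj_on[OF t], of "i div 2" "j div 2"]
        by (simp add: h_def)
    qed
    with par show "i = j" by presburger
  qed
  then have "distinct (map h [0..<L])" by (simp add: distinct_map lessThan_atLeast0)
  moreover have "h ` {..<L} = X \<union> Y"
  proof (intro equalityI subsetI)
    fix x assume "x \<in> X \<union> Y"
    then consider i where "i < N" "x = \<sigma> i" | i where "i < N - 1" "x = \<tau> i"
      using s t by (auto simp: bij_betw_def)
    then show "x \<in> h ` {..<L}"
    proof cases
      case 1
      then show ?thesis by (intro image_eqI[of _ _ "2 * i"]) (auto simp: h_def L_def)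
    next
      case 2
      then show ?thesis by (intro image_eqI[of _ _ "2 * i + 1"]) (auto simp: h_def L_def)
    qed
  next
    fix x assume "x \<in> h ` {..<L}"
    then show "x \<in> X \<union> Y" using hX hY by blast
  qed
  then have "set (map h [0..<L]) = X \<union> Y" by (simp add: lessThan_atLeast0)
  moreover have "{h i, h (Suc i)} \<in> E" if "Suc i < L" for i
  proof (cases "even i")
    case True
    then show ?thesis using that E(1)[of "i div 2"] by (auto simp: h_def L_def elim!: evenE)
  next
    case False
    then show ?thesis using that E(2)[of "i div 2"] by (auto simp: h_def L_def insert_commute elim!: oddE)
  qed
  moreover have "L > 0" "(L - 1) div 2 = N - 1" "even (L - 1)" using N by (auto simp: L_def)
  moreover have "last (map h [0..<L]) = h (L - 1)" "hd (map h [0..<L]) = h 0"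
    using \<open>L > 0\<close> by (simp_all add: last_map hd_map)
  ultimately show ?thesis
    unfolding ham_path_def by (intro exI[of _ "map h [0..<L]"]) (auto simp: h_def)
qed

text \<open>A Hamiltonian path from \<open>u\<close> to \<open>v\<close> is a Hamiltonian cycle through an additional vertex of
  the small side joined to \<open>u\<close> and \<open>v\<close> only. The name \<open>u\<close>, unused on that side, serves as
  its label.\<close>

lemma ham_path_of_ham_cyc:
  assumes uv: "u \<in> X" "v \<in> X" "u \<noteq> v" and disj: "X \<inter> Y = {}" and fin: "finite X"
    and cyc: "ham_cyc X (insert u Y) (\<lambda>x z. if z = u then x = u \<or> x = v else {x, z} \<in> E)"
  shows "ham_path (X \<union> Y) E u v"
proof -
  define N where "N = card X"
  obtain \<sigma> \<tau> where st: "bij_betw \<sigma> {..<N} X" "bij_betw \<tau> {..<N} (insert u Y)"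
    and R: "\<And>i. i < N \<Longrightarrow> if \<tau> i = u then \<sigma> i = u \<or> \<sigma> i = v else {\<sigma> i, \<tau> i} \<in> E"
      "\<And>i. Suc i < N \<Longrightarrow> if \<tau> i = u then \<sigma> (Suc i) = u \<or> \<sigma> (Suc i) = v else {\<sigma> (Suc i), \<tau> i} \<in> E"
      "if \<tau> (N - 1) = u then \<sigma> 0 = u \<or> \<sigma> 0 = v else {\<sigma> 0, \<tau> (N - 1)} \<in> E" "\<tau> (N - 1) = u"
    unfolding N_def by (rule ham_cyc_rotate[OF cyc, of u]) auto
  have "card {u, v} \<le> N" unfolding N_def using uv fin by (intro card_mono) auto
  then have N2: "N \<ge> 2" using uv by simp
  have u: "i = N - 1" if "i < N" "\<tau> i = u" for i
    using inj_onD[OF bij_betw_imp_inj_on[OF st(2)], of i "N - 1"] that R(4) by auto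
  have "bij_betw \<tau> ({..<N} - {N - 1}) (insert u Y - {\<tau> (N - 1)})"
    using st(2) N2 by (intro bij_betw_DiffI) (auto simp: R(4)[simplified])
  moreover have "{..<N} - {N - 1} = {..<N - 1}" using N2 by auto
  moreover have "insert u Y - {\<tau> (N - 1)} = Y" using R(4) uv disj by auto
  ultimately have t: "bij_betw \<tau> {..<N - 1} Y" by simp
  have "ham_path (X \<union> Y) E (\<sigma> 0) (\<sigma> (N - 1))"
  proof (rule ham_path_of_alternating[OF _ st(1) t disj])
    fix i assume i: "Suc i < N"
    then have "\<tau> i \<noteq> u" using u[of i] by auto
    then show "{\<sigma> i, \<tau> i} \<in> E" "{\<sigma> (Suc i), \<tau> i} \<in> E" using R(1,2)[of i] i by auto
  qed (use N2 in simp)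
  moreover have "\<sigma> 0 \<noteq> \<sigma> (N - 1)"
    using inj_onD[OF bij_betw_imp_inj_on[OF st(1)], of 0 "N - 1"] N2 by auto
  \<comment> \<open>The ends of the path are the two neighbours of the artificial vertex on the
    cycle; being distinct, they are \<open>u\<close> and \<open>v\<close> in one of the two
    orders.\<close>
  moreover have "\<sigma> 0 = u \<or> \<sigma> 0 = v" "\<sigma> (N - 1) = u \<or> \<sigma> (N - 1) = v"
    using R(1)[of "N - 1"] R(3,4) N2 by auto
  ultimately show ?thesis using ham_path_sym by metis
qed

section \<open>Spectral radius of bipartite graphs\<close>

lemma qform_mono:
  assumes "E \<subseteq> E'" "\<And>v. f v \<ge> 0"
  shows "qform V E f \<le> qform V E' f"
  unfolding qform_def using assms
  by (intro sum_mono mult_right_mono adj_mono) auto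

lemma eigenfun_norm_pos:
  assumes "finite V" "eigenfun V E r f"
  shows "(\<Sum>v\<in>V. (f v)\<^sup>2) > 0"
proof -
  obtain v where "v \<in> V" "f v \<noteq> 0" using assms(2) by (auto simp: eigenfun_def)
  then show ?thesis using assms(1) by (intro sum_squares_pos)
qed

text \<open>A nonnegative eigenvector of the smaller graph is used as a test function for the larger
  one.\<close>

lemma spec_rad_mono:
  assumes "finite V" "V \<noteq> {}" "E \<subseteq> E'"
  shows "spec_rad V E \<le> spec_rad V E'"
proof -
  obtain f where f: "eigenfun V E (spec_rad V E) f" "\<And>v. f v \<ge> 0"
    using spec_rad_Rayleigh(2)[OF assms(1,2), of E] by blast
  have "spec_rad V E * (\<Sum>v\<in>V. (f v)\<^sup>2) \<le> spec_rad V E' * (\<Sum>v\<in>V. (f v)\<^sup>2)"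
    using qform_eigenfun[OF f(1)] qform_mono[OF assms(3), of f V] f(2)
      spec_rad_Rayleigh(1)[OF assms(1,2), of E' f] by simp
  then show ?thesis using eigenfun_norm_pos[OF assms(1) f(1)] by simp
qed

lemma graph_iso_sym:
  assumes "graph_iso V E V' E'"
  shows "graph_iso V' E' V E"
proof -
  obtain f where f: "bij_betw f V V'" "\<And>x y. x \<in> V \<Longrightarrow> y \<in> V \<Longrightarrow> {x, y} \<in> E \<longleftrightarrow> {f x, f y} \<in> E'"
    using assms unfolding graph_iso_def by blast
  define g where "g = the_inv_into V f"
  have g: "bij_betw g V' V" unfolding g_def using f(1) by (rule bij_betw_the_inv_into)
  have fg: "f (g y) = y" if "y \<in> V'" for y
    using f(1) that f_the_inv_into_f_bij_betw unfolding g_def by metis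
  have "{x, y} \<in> E' \<longleftrightarrow> {g x, g y} \<in> E" if "x \<in> V'" "y \<in> V'" for x y
    using f(2)[of "g x" "g y"] fg that bij_betwE[OF g] by simp
  then show ?thesis unfolding graph_iso_def using g by blast
qed

text \<open>An eigenfunction of the image graph, pulled back along the isomorphism, has the same
  form value and norm.\<close>

lemma spec_rad_iso_le:
  assumes fin: "finite V" "V \<noteq> {}" and iso: "graph_iso V E V' E'"
  shows "spec_rad V' E' \<le> spec_rad V E"
proof -
  obtain h where h: "bij_betw h V V'" "\<And>x y. x \<in> V \<Longrightarrow> y \<in> V \<Longrightarrow> {x, y} \<in> E \<longleftrightarrow> {h x, h y} \<in> E'"
    using iso unfolding graph_iso_def by blast
  have fin': "finite V'" "V' \<noteq> {}"
    using h(1) fin bij_betw_finite by (auto simp: bij_betw_def)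
  obtain f where f: "eigenfun V' E' (spec_rad V' E') f"
    using spec_rad_Rayleigh(2)[OF fin', of E'] by blast
  have "qform V E (f \<circ> h) = (\<Sum>v\<in>V. \<Sum>u\<in>V. adj E' (h v) (h u) * f (h v) * f (h u))"
    unfolding qform_def by (intro sum.cong refl) (simp add: adj_def h(2))
  also have "\<dots> = qform V' E' f"
    unfolding qform_def
    by (simp add: sum.reindex_bij_betw[OF h(1), symmetric])
  also have "\<dots> = spec_rad V' E' * (\<Sum>v\<in>V'. (f v)\<^sup>2)"
    by (rule qform_eigenfun[OF f])
  finally have "spec_rad V' E' * (\<Sum>v\<in>V'. (f v)\<^sup>2) \<le> spec_rad V E * (\<Sum>v\<in>V. ((f \<circ> h) v)\<^sup>2)"
    using spec_rad_Rayleigh(1)[OF fin, of E "f \<circ> h"] by simp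
  also have "(\<Sum>v\<in>V. ((f \<circ> h) v)\<^sup>2) = (\<Sum>v\<in>V'. (f v)\<^sup>2)"
    using sum.reindex_bij_betw[OF h(1), of "\<lambda>v. (f v)\<^sup>2"] by simp
  finally show ?thesis using eigenfun_norm_pos[OF fin'(1) f] by simp
qed

lemma spec_rad_iso:
  assumes "finite V" "V \<noteq> {}" "graph_iso V E V' E'"
  shows "spec_rad V E = spec_rad V' E'"
proof -
  have "finite V'" "V' \<noteq> {}"
    using assms by (auto simp: graph_iso_def bij_betw_def)
  then show ?thesis
    using spec_rad_iso_le[OF assms] spec_rad_iso_le[OF _ _ graph_iso_sym[OF assms(3)]] by simp
qed

text \<open>The test function is the Perron vector of the complete bipartite graph between
  \<open>A\<close> and \<open>B\<close>: \<open>sqrt (card B)\<close> on \<open>A\<close> and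
  \<open>sqrt (card A)\<close> on \<open>B\<close>. Further edges only add nonnegative
  terms.\<close>

lemma spec_rad_complete_bip:
  assumes fin: "finite V" and AB: "A \<subseteq> V" "B \<subseteq> V" "A \<inter> B = {}" "A \<noteq> {}" "B \<noteq> {}"
    and E: "\<And>x y. x \<in> A \<Longrightarrow> y \<in> B \<Longrightarrow> {x, y} \<in> E"
  shows "spec_rad V E > 0" "real (card A) * real (card B) \<le> (spec_rad V E)\<^sup>2"
proof -
  define a where "a = real (card A)"
  define b where "b = real (card B)"
  have finAB: "finite A" "finite B" using fin AB by (simp_all add: finite_subset)
  have pos: "a > 0" "b > 0" using finAB AB by (auto simp: a_def b_def card_gt_0_iff)
  define g where "g v = (if v \<in> A then sqrt b else if v \<in> B then sqrt a else 0)" for v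
  have g0: "g v \<ge> 0" for v using pos by (simp add: g_def)
  have gA: "g v = sqrt b" if "v \<in> A" for v using that by (simp add: g_def)
  have gB: "g v = sqrt a" if "v \<in> B" for v using that AB(3) by (auto simp: g_def)
  have sub: "A \<union> B \<subseteq> V" using AB by auto
  have "(\<Sum>v\<in>V. (g v)\<^sup>2) = (\<Sum>v\<in>A \<union> B. (g v)\<^sup>2)"
    using fin sub by (intro sum.mono_neutral_right) (auto simp: g_def)
  also have "\<dots> = (\<Sum>v\<in>A. (g v)\<^sup>2) + (\<Sum>v\<in>B. (g v)\<^sup>2)"
    using finAB AB(3) by (intro sum.union_disjoint)
  also have "(\<Sum>v\<in>A. (g v)\<^sup>2) = a * b" using pos by (simp add: gA a_def)
  also have "(\<Sum>v\<in>B. (g v)\<^sup>2) = a * b" using pos by (simp add: gB b_def)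
  finally have norm: "(\<Sum>v\<in>V. (g v)\<^sup>2) = 2 * (a * b)" by simp
  have rowA: "b * sqrt a \<le> (\<Sum>u\<in>V. adj E v u * g u)" if "v \<in> A" for v
  proof -
    have "b * sqrt a = (\<Sum>u\<in>B. adj E v u * g u)"
      using E that by (simp add: gB b_def adj_def)
    also have "\<dots> \<le> (\<Sum>u\<in>V. adj E v u * g u)"
      using fin AB g0 by (intro sum_mono2) (auto simp: adj_nonneg)
    finally show ?thesis .
  qed
  have rowB: "a * sqrt b \<le> (\<Sum>u\<in>V. adj E v u * g u)" if "v \<in> B" for v
  proof -
    have "a * sqrt b = (\<Sum>u\<in>A. adj E v u * g u)"
      using E that by (simp add: gA a_def adj_def insert_commute)
    also have "\<dots> \<le> (\<Sum>u\<in>V. adj E v u * g u)"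
      using fin AB g0 by (intro sum_mono2) (auto simp: adj_nonneg)
    finally show ?thesis .
  qed
  have "2 * (a * b) * sqrt (a * b) = (\<Sum>v\<in>A. sqrt b * (b * sqrt a)) + (\<Sum>v\<in>B. sqrt a * (a * sqrt b))"
    by (simp add: a_def b_def real_sqrt_mult)
  also have "\<dots> \<le> (\<Sum>v\<in>A. g v * (\<Sum>u\<in>V. adj E v u * g u)) + (\<Sum>v\<in>B. g v * (\<Sum>u\<in>V. adj E v u * g u))"
    using pos rowA rowB by (intro add_mono sum_mono) (auto simp: gA gB intro!: mult_left_mono)
  also have "\<dots> = (\<Sum>v\<in>A \<union> B. g v * (\<Sum>u\<in>V. adj E v u * g u))"
    using finAB AB(3) by (intro sum.union_disjoint[symmetric])
  also have "\<dots> \<le> (\<Sum>v\<in>V. g v * (\<Sum>u\<in>V. adj E v u * g u))"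
    using fin sub g0 by (intro sum_mono2) (auto intro!: mult_nonneg_nonneg sum_nonneg simp: adj_nonneg)
  also have "\<dots> = qform V E g"
    by (simp add: qform_def sum_distrib_left mult_ac)
  also have "\<dots> \<le> spec_rad V E * (2 * (a * b))"
    using spec_rad_Rayleigh(1)[OF fin, of E g] AB norm by auto
  finally have le: "sqrt (a * b) \<le> spec_rad V E"
    using pos by (simp add: mult.commute)
  moreover have "sqrt (a * b) > 0" using pos by simp
  ultimately show "spec_rad V E > 0" by linarith
  have "(sqrt (a * b))\<^sup>2 \<le> (spec_rad V E)\<^sup>2"
    using le pos by (intro power_mono) auto
  then show "real (card A) * real (card B) \<le> (spec_rad V E)\<^sup>2"
    using pos by (simp add: a_def b_def)
qed

section \<open>Spectral radius and number of edges under a minimum degree\<close>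

lemma bip_graph_edge:
  assumes "bip_graph X Y E" "{a, b} \<in> E"
  shows "a \<in> X \<and> b \<in> Y \<or> a \<in> Y \<and> b \<in> X"
  using assms unfolding bip_graph_def by (auto simp: doubleton_eq_iff dest!: bspec)

lemma bip_degree:
  assumes "bip_graph X Y E"
  shows "x \<in> X \<Longrightarrow> degree E x = card {y\<in>Y. {x, y} \<in> E}"
    and "y \<in> Y \<Longrightarrow> degree E y = card {x\<in>X. {x, y} \<in> E}"
proof -
  have disj: "X \<inter> Y = {}" using assms by (simp add: bip_graph_def)
  show "degree E x = card {y\<in>Y. {x, y} \<in> E}" if "x \<in> X"
  proof -
    have "{u. {u, x} \<in> E} = {y\<in>Y. {x, y} \<in> E}"
      using that disj by (auto simp: insert_commute dest: bip_graph_edge[OF assms])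
    then show ?thesis by (simp add: degree_def)
  qed
  show "degree E y = card {x\<in>X. {x, y} \<in> E}" if "y \<in> Y"
  proof -
    have "{u. {u, y} \<in> E} = {x\<in>X. {x, y} \<in> E}"
      using that disj by (auto dest: bip_graph_edge[OF assms])
    then show ?thesis by (simp add: degree_def)
  qed
qed

lemma bip_eigenfun:
  assumes bip: "bip_graph X Y E" and ef: "eigenfun (X \<union> Y) E r f"
  shows "x \<in> X \<Longrightarrow> (\<Sum>y\<in>Y. adj E x y * f y) = r * f x"
    and "y \<in> Y \<Longrightarrow> (\<Sum>x\<in>X. adj E x y * f x) = r * f y"
proof -
  have fin: "finite X" "finite Y" and disj: "X \<inter> Y = {}" using bip by (auto simp: bip_graph_def)
  have split: "(\<Sum>u\<in>X \<union> Y. adj E v u * f u) = (\<Sum>u\<in>X. adj E v u * f u) + (\<Sum>u\<in>Y. adj E v u * f u)" for v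
    using fin disj by (intro sum.union_disjoint)
  show "(\<Sum>y\<in>Y. adj E x y * f y) = r * f x" if "x \<in> X"
  proof -
    have "(\<Sum>u\<in>X. adj E x u * f u) = 0"
      using that disj by (intro sum.neutral) (auto simp: adj_def dest: bip_graph_edge[OF bip])
    then show ?thesis using ef that split[of x] by (simp add: eigenfun_def)
  qed
  show "(\<Sum>x\<in>X. adj E x y * f x) = r * f y" if "y \<in> Y"
  proof -
    have "(\<Sum>u\<in>Y. adj E y u * f u) = 0"
      using that disj by (intro sum.neutral) (auto simp: adj_def dest: bip_graph_edge[OF bip])
    moreover have "(\<Sum>u\<in>X \<union> Y. adj E y u * f u) = r * f y"
      using ef that by (simp add: eigenfun_def)
    ultimately show ?thesis using split[of y] by (simp add: adj_sym[of E y])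
  qed
qed

lemma sum_adj_left: "finite Y \<Longrightarrow> (\<Sum>y\<in>Y. adj E x y) = real (card {y\<in>Y. {x, y} \<in> E})"
  by (simp add: adj_def sum.inter_filter[symmetric] of_bool_def)

lemma sum_adj_right: "finite X \<Longrightarrow> (\<Sum>x\<in>X. adj E x y) = real (card {x\<in>X. {x, y} \<in> E})"
  by (simp add: adj_def sum.inter_filter[symmetric] of_bool_def)

lemma edges_plus_nonedges:
  assumes "finite X" "finite Y"
  shows "(\<Sum>x\<in>X. \<Sum>y\<in>Y. adj E x y) = real (card X * card Y) - real (nonedges X Y (\<lambda>x y. {x, y} \<in> E))"
proof -
  have "nonedges X Y (\<lambda>x y. {x, y} \<in> E) = card (SIGMA x:X. {y\<in>Y. {x, y} \<notin> E})"
    unfolding nonedges_def by (rule arg_cong[where f = card]) auto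
  also have "\<dots> = (\<Sum>x\<in>X. card {y\<in>Y. {x, y} \<notin> E})"
    using assms by (simp add: card_SigmaI)
  finally have "real (nonedges X Y (\<lambda>x y. {x, y} \<in> E)) = (\<Sum>x\<in>X. real (card {y\<in>Y. {x, y} \<notin> E}))"
    by simp
  moreover have "(\<Sum>x\<in>X. \<Sum>y\<in>Y. adj E x y) = (\<Sum>x\<in>X. real (card {y\<in>Y. {x, y} \<in> E}))"
    using assms by (simp add: sum_adj_left)
  moreover have "real (card {y\<in>Y. {x, y} \<in> E}) + real (card {y\<in>Y. {x, y} \<notin> E}) = card Y" for x
    using card_filter_compl[OF assms(2), of "\<lambda>y. {x, y} \<in> E"] by (simp flip: of_nat_add)
  ultimately have "(\<Sum>x\<in>X. \<Sum>y\<in>Y. adj E x y) + real (nonedges X Y (\<lambda>x y. {x, y} \<in> E)) = (\<Sum>x\<in>X. real (card Y))"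
    by (simp add: sum.distrib[symmetric])
  then show ?thesis by simp
qed

text \<open>Summing the eigenvalue equation of the square of the adjacency matrix over one side: the
  neighbours of \<open>x\<close> have total degree at most \<open>e - k (card Y - deg x)\<close>.\<close>

lemma two_step_bound:
  fixes B :: "'a \<Rightarrow> 'b \<Rightarrow> real" and f :: "'a \<Rightarrow> real" and g :: "'b \<Rightarrow> real"
  assumes f0: "\<And>x. x \<in> X \<Longrightarrow> f x \<ge> 0"
    and B: "\<And>x y. x \<in> X \<Longrightarrow> y \<in> Y \<Longrightarrow> 0 \<le> B x y \<and> B x y \<le> 1"
    and ef: "\<And>x. x \<in> X \<Longrightarrow> (\<Sum>y\<in>Y. B x y * g y) = r * f x"
    and eg: "\<And>y. y \<in> Y \<Longrightarrow> (\<Sum>x\<in>X. B x y * f x) = r * g y"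
    and deg: "\<And>y. y \<in> Y \<Longrightarrow> k \<le> (\<Sum>x\<in>X. B x y)"
  shows "(r\<^sup>2 - (\<Sum>x\<in>X. \<Sum>y\<in>Y. B x y) + k * card Y) * (\<Sum>x\<in>X. f x) \<le> k * r * (\<Sum>y\<in>Y. g y)"
proof -
  define d where "d y = (\<Sum>x\<in>X. B x y)" for y
  define e where "e = (\<Sum>x\<in>X. \<Sum>y\<in>Y. B x y)"
  have e: "e = (\<Sum>y\<in>Y. d y)" unfolding e_def d_def by (rule sum.swap)
  have row: "(\<Sum>y\<in>Y. B x y * d y) \<le> e - k * card Y + k * (\<Sum>y\<in>Y. B x y)" if "x \<in> X" for x
  proof -
    have "k * card Y - k * (\<Sum>y\<in>Y. B x y) = (\<Sum>y\<in>Y. (1 - B x y) * k)"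
      by (simp add: left_diff_distrib sum_subtractf sum_distrib_left mult.commute[of k])
    also have "\<dots> \<le> (\<Sum>y\<in>Y. (1 - B x y) * d y)"
      using B[OF that] deg by (intro sum_mono mult_left_mono) (auto simp: d_def)
    also have "\<dots> = e - (\<Sum>y\<in>Y. B x y * d y)"
      by (simp add: e left_diff_distrib sum_subtractf)
    finally show ?thesis by simp
  qed
  have "r * (\<Sum>x\<in>X. f x) = (\<Sum>x\<in>X. \<Sum>y\<in>Y. B x y * g y)"
    by (simp add: ef sum_distrib_left)
  also have "\<dots> = (\<Sum>y\<in>Y. d y * g y)"
    unfolding d_def sum_distrib_right by (rule sum.swap)
  finally have "r * (r * (\<Sum>x\<in>X. f x)) = r * (\<Sum>y\<in>Y. d y * g y)" by simp
  then have "r\<^sup>2 * (\<Sum>x\<in>X. f x) = (\<Sum>y\<in>Y. d y * (r * g y))"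
    by (simp add: power2_eq_square mult.assoc sum_distrib_left[of r "\<lambda>y. d y * g y"] mult.left_commute)
  also have "\<dots> = (\<Sum>y\<in>Y. \<Sum>x\<in>X. f x * (B x y * d y))"
    by (intro sum.cong refl) (simp add: eg[symmetric] sum_distrib_left mult_ac)
  also have "\<dots> = (\<Sum>x\<in>X. f x * (\<Sum>y\<in>Y. B x y * d y))"
    by (subst sum.swap) (simp add: sum_distrib_left)
  also have "\<dots> \<le> (\<Sum>x\<in>X. f x * (e - k * card Y + k * (\<Sum>y\<in>Y. B x y)))"
    using row f0 by (intro sum_mono mult_left_mono) auto
  also have "\<dots> = (e - k * card Y) * (\<Sum>x\<in>X. f x) + k * (\<Sum>x\<in>X. \<Sum>y\<in>Y. B x y * f x)"
    by (simp add: distrib_left sum.distrib sum_distrib_left sum_distrib_right mult_ac)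
  also have "(\<Sum>x\<in>X. \<Sum>y\<in>Y. B x y * f x) = r * (\<Sum>y\<in>Y. g y)"
    by (subst sum.swap) (simp add: eg sum_distrib_left)
  finally show ?thesis by (simp add: e_def algebra_simps)
qed

text \<open>\<open>two_step_bound\<close>, applied from each side, gives two linear inequalities
  between the side sums \<open>F\<close> and \<open>G\<close> of a nonnegative eigenfunction. They
  are multiplied and \<open>F * G\<close> is cancelled.\<close>

lemma bip_spec_rad_bound:
  assumes bip: "bip_graph X Y E" and deg: "min_degree_ge (X \<union> Y) E k" and ne: "X \<union> Y \<noteq> {}"
    and r: "r = spec_rad (X \<union> Y) E" "r > 0"
    and e: "e = real (card X * card Y) - real (nonedges X Y (\<lambda>x y. {x, y} \<in> E))"
    and nn: "r\<^sup>2 - e + real k * card Y \<ge> 0"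
  shows "(r\<^sup>2 - e + real k * card Y) * (r\<^sup>2 - e + real k * card X) \<le> (real k)\<^sup>2 * r\<^sup>2"
proof -
  have fin: "finite X" "finite Y" using bip by (auto simp: bip_graph_def)
  obtain f where f: "eigenfun (X \<union> Y) E r f" "\<And>v. f v \<ge> 0"
    using spec_rad_Rayleigh(2)[of "X \<union> Y" E] fin ne r(1) by auto
  define F where "F = (\<Sum>x\<in>X. f x)"
  define G where "G = (\<Sum>y\<in>Y. f y)"
  have e': "e = (\<Sum>x\<in>X. \<Sum>y\<in>Y. adj E x y)"
    using edges_plus_nonedges[OF fin] e by simp
  then have e'': "e = (\<Sum>y\<in>Y. \<Sum>x\<in>X. adj E x y)"
    by (subst sum.swap)
  note ef = bip_eigenfun[OF bip f(1)]
  have a01: "0 \<le> adj E x y \<and> adj E x y \<le> 1" for x y by (simp add: adj_def)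
  have 1: "(r\<^sup>2 - e + real k * card Y) * F \<le> real k * r * G"
    unfolding e' F_def G_def
  proof (rule two_step_bound)
    show "real k \<le> (\<Sum>x\<in>X. adj E x y)" if "y \<in> Y" for y
      using deg that fin by (auto simp: sum_adj_right min_degree_ge_def bip_degree(2)[OF bip that, symmetric])
  qed (use ef f(2) a01 in auto)
  have 2: "(r\<^sup>2 - e + real k * card X) * G \<le> real k * r * F"
    unfolding e'' F_def G_def
  proof (rule two_step_bound)
    show "real k \<le> (\<Sum>y\<in>Y. adj E x y)" if "x \<in> X" for x
      using deg that fin by (auto simp: sum_adj_left min_degree_ge_def bip_degree(1)[OF bip that, symmetric])
  qed (use ef f(2) a01 in auto)
  have F0: "F \<ge> 0" "G \<ge> 0" unfolding F_def G_def using f(2) by (auto intro: sum_nonneg)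
  \<comment> \<open>If one sum were zero, \<open>f\<close> would vanish on that side, and because
    \<open>r > 0\<close> the eigenvalue equation would make it vanish on the other side too.\<close>
  have "F > 0 \<and> G > 0"
  proof (rule ccontr)
    assume "\<not> ?thesis"
    then consider "F = 0" | "G = 0" using F0 by linarith
    then have "\<forall>v\<in>X \<union> Y. f v = 0"
    proof cases
      case 1
      then have X: "\<forall>x\<in>X. f x = 0" using fin f(2) by (simp add: F_def sum_nonneg_eq_0_iff)
      moreover have "f y = 0" if "y \<in> Y" for y
        using ef(2)[OF that] X r(2) by simp
      ultimately show ?thesis by blast
    next
      case 2
      then have Y: "\<forall>y\<in>Y. f y = 0" using fin f(2) by (simp add: G_def sum_nonneg_eq_0_iff)
      moreover have "f x = 0" if "x \<in> X" for x
        using ef(1)[OF that] Y r(2) by simp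
      ultimately show ?thesis by blast
    qed
    then show False using f(1) by (auto simp: eigenfun_def)
  qed
  then have pos: "F * G > 0" by simp
  \<comment> \<open>Multiplying the inequalities requires a nonnegative second factor; if it is
    negative, the product is at most 0 anyway.\<close>
  show ?thesis
  proof (cases "r\<^sup>2 - e + real k * card X \<ge> 0")
    case True
    have "((r\<^sup>2 - e + real k * card Y) * F) * ((r\<^sup>2 - e + real k * card X) * G)
        \<le> (real k * r * G) * (real k * r * F)"
      using r(2) by (intro mult_mono[OF 1 2]) (simp_all add: True nn F0)
    then have "((r\<^sup>2 - e + real k * card Y) * (r\<^sup>2 - e + real k * card X)) * (F * G)
        \<le> ((real k)\<^sup>2 * r\<^sup>2) * (F * G)"
      by (simp add: power2_eq_square mult_ac)
    then show ?thesis using pos by (simp only: mult_le_cancel_right_pos)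
  next
    case False
    then have "(r\<^sup>2 - e + real k * card Y) * (r\<^sup>2 - e + real k * card X) \<le> 0"
      using nn by (intro mult_nonneg_nonpos) auto
    also have "0 \<le> (real k)\<^sup>2 * r\<^sup>2" by simp
    finally show ?thesis .
  qed
qed

section \<open>Complete bipartite graphs with a missing block\<close>

text \<open>These are the graphs \<open>M_E\<close> with freely chosen parts, so that a supergraph
  of \<open>G\<close> of this shape can live on the vertices of \<open>G\<close> itself.\<close>

definition block_graph :: "'a set \<Rightarrow> 'a set \<Rightarrow> 'a set \<Rightarrow> 'a set \<Rightarrow> 'a set set" where
  "block_graph X Y X\<^sub>1 Y\<^sub>2 = {{x, y} | x y. x \<in> X \<and> y \<in> Y \<and> \<not> (x \<in> X\<^sub>1 \<and> y \<in> Y\<^sub>2)}"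

lemma block_graph_iff:
  "{a, b} \<in> block_graph X Y X\<^sub>1 Y\<^sub>2 \<longleftrightarrow>
    a \<in> X \<and> b \<in> Y \<and> \<not> (a \<in> X\<^sub>1 \<and> b \<in> Y\<^sub>2) \<or> b \<in> X \<and> a \<in> Y \<and> \<not> (b \<in> X\<^sub>1 \<and> a \<in> Y\<^sub>2)"
  by (auto simp: block_graph_def doubleton_eq_iff)

lemma bip_block_graph:
  "finite X \<Longrightarrow> finite Y \<Longrightarrow> X \<inter> Y = {} \<Longrightarrow> bip_graph X Y (block_graph X Y X\<^sub>1 Y\<^sub>2)"
  by (auto simp: bip_graph_def block_graph_def)

lemma subset_block_graphI:
  assumes "bip_graph X Y E" "\<And>x y. x \<in> X\<^sub>1 \<Longrightarrow> y \<in> Y\<^sub>2 \<Longrightarrow> {x, y} \<notin> E"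
  shows "E \<subseteq> block_graph X Y X\<^sub>1 Y\<^sub>2"
proof
  fix e assume e: "e \<in> E"
  then obtain x y where "x \<in> X" "y \<in> Y" "e = {x, y}"
    using assms(1) by (auto simp: bip_graph_def)
  then show "e \<in> block_graph X Y X\<^sub>1 Y\<^sub>2"
    using e assms(2) by (auto simp: block_graph_iff)
qed

lemma M_E_block_graph:
  assumes "s \<le> n" "t \<le> m"
  shows "M_E n m s t = block_graph (M_X n) (M_Y m) (Inl ` {..<s}) (Inr ` {m - t..<m})"
proof (intro equalityI subsetI)
  fix e assume "e \<in> M_E n m s t"
  then show "e \<in> block_graph (M_X n) (M_Y m) (Inl ` {..<s}) (Inr ` {m - t..<m})"
    by (auto simp: M_E_def block_graph_iff M_X_def M_Y_def)
next
  fix e assume "e \<in> block_graph (M_X n) (M_Y m) (Inl ` {..<s}) (Inr ` {m - t..<m})"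
  then obtain x y where xy: "e = {x, y}" "x \<in> Inl ` {..<n}" "y \<in> Inr ` {..<m}"
    "\<not> (x \<in> Inl ` {..<s} \<and> y \<in> Inr ` {m - t..<m})"
    unfolding block_graph_def M_X_def M_Y_def by blast
  obtain i j where "x = Inl i" "y = Inr j" "i < n" "j < m" using xy(2,3) by auto
  with xy have e: "e = {Inl i, Inr j}" "i < n" "j < m" and "\<not> (i < s \<and> m - t \<le> j)" by auto
  then have "i < s \<and> j < m - t \<or> s \<le> i \<and> j < m - t \<or> s \<le> i \<and> m - t \<le> j" by linarith
  with e show "e \<in> M_E n m s t" unfolding M_E_def by blast
qed

lemma bij_betw_extend_subset:
  assumes fin: "finite A" "finite A'" and sub: "S \<subseteq> A" "S' \<subseteq> A'"
    and card: "card A = card A'" "card S = card S'"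
  obtains f where "bij_betw f A A'" "\<And>x. x \<in> A \<Longrightarrow> f x \<in> S' \<longleftrightarrow> x \<in> S"
proof -
  have finS: "finite S" "finite S'" using fin sub by (simp_all add: finite_subset)
  obtain g where g: "bij_betw g S S'"
    using finite_same_card_bij[OF finS card(2)] by blast
  have "card (A - S) = card (A' - S')"
    using card sub finS by (simp add: card_Diff_subset)
  then obtain h where h: "bij_betw h (A - S) (A' - S')"
    using finite_same_card_bij[of "A - S" "A' - S'"] fin by blast
  define f where "f x = (if x \<in> S then g x else h x)" for x
  have "bij_betw f S S'" using g by (rule bij_betw_cong[THEN iffD1, rotated]) (simp add: f_def)
  moreover have "bij_betw f (A - S) (A' - S')"
    using h by (rule bij_betw_cong[THEN iffD1, rotated]) (simp add: f_def)
  ultimately have "bij_betw f (S \<union> (A - S)) (S' \<union> (A' - S'))"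
    by (rule bij_betw_combine) auto
  moreover have "S \<union> (A - S) = A" "S' \<union> (A' - S') = A'" using sub by auto
  ultimately have "bij_betw f A A'" by simp
  moreover have "f x \<in> S' \<longleftrightarrow> x \<in> S" if "x \<in> A" for x
    using that bij_betwE[OF g] bij_betwE[OF h] by (auto simp: f_def)
  ultimately show thesis using that by blast
qed

lemma block_graph_iso:
  assumes fin: "finite X" "finite Y" "finite X'" "finite Y'"
    and disj: "X \<inter> Y = {}" "X' \<inter> Y' = {}"
    and sub: "X\<^sub>1 \<subseteq> X" "Y\<^sub>2 \<subseteq> Y" "X\<^sub>1' \<subseteq> X'" "Y\<^sub>2' \<subseteq> Y'"
    and card: "card X = card X'" "card Y = card Y'" "card X\<^sub>1 = card X\<^sub>1'" "card Y\<^sub>2 = card Y\<^sub>2'"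
  shows "graph_iso (X \<union> Y) (block_graph X Y X\<^sub>1 Y\<^sub>2) (X' \<union> Y') (block_graph X' Y' X\<^sub>1' Y\<^sub>2')"
proof -
  obtain g where g: "bij_betw g X X'" "\<And>x. x \<in> X \<Longrightarrow> g x \<in> X\<^sub>1' \<longleftrightarrow> x \<in> X\<^sub>1"
    using bij_betw_extend_subset[OF fin(1,3) sub(1,3) card(1,3)] by blast
  obtain h where h: "bij_betw h Y Y'" "\<And>y. y \<in> Y \<Longrightarrow> h y \<in> Y\<^sub>2' \<longleftrightarrow> y \<in> Y\<^sub>2"
    using bij_betw_extend_subset[OF fin(2,4) sub(2,4) card(2,4)] by blast
  define f where "f v = (if v \<in> X then g v else h v)" for v
  have fX: "f x = g x" if "x \<in> X" for x using that by (simp add: f_def)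
  have fY: "f y = h y" if "y \<in> Y" for y using that disj(1) by (auto simp: f_def)
  have "bij_betw f X X'" using g(1) by (rule bij_betw_cong[THEN iffD1, rotated]) (simp add: fX)
  moreover have "bij_betw f Y Y'" using h(1) by (rule bij_betw_cong[THEN iffD1, rotated]) (simp add: fY)
  ultimately have b: "bij_betw f (X \<union> Y) (X' \<union> Y')" using disj(2) by (rule bij_betw_combine)
  have memX: "f x \<in> X'" "f x \<notin> Y'" "f x \<in> X\<^sub>1' \<longleftrightarrow> x \<in> X\<^sub>1" "x \<notin> Y" if "x \<in> X" for x
    using that bij_betwE[OF g(1)] g(2) disj by (auto simp: fX)
  have memY: "f y \<in> Y'" "f y \<notin> X'" "f y \<in> Y\<^sub>2' \<longleftrightarrow> y \<in> Y\<^sub>2" "y \<notin> X" if "y \<in> Y" for y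
    using that bij_betwE[OF h(1)] h(2) disj by (auto simp: fY)
  show ?thesis
    unfolding graph_iso_def
  proof (intro exI[of _ f] conjI ballI b)
    fix a c assume "a \<in> X \<union> Y" "c \<in> X \<union> Y"
    then show "{a, c} \<in> block_graph X Y X\<^sub>1 Y\<^sub>2 \<longleftrightarrow> {f a, f c} \<in> block_graph X' Y' X\<^sub>1' Y\<^sub>2'"
      unfolding block_graph_iff using memX[of a] memX[of c] memY[of a] memY[of c] by blast
  qed
qed

lemma block_graph_iso_M:
  assumes "finite X" "finite Y" "X \<inter> Y = {}" "X\<^sub>1 \<subseteq> X" "Y\<^sub>2 \<subseteq> Y"
    and "card X = n" "card Y = m" "card X\<^sub>1 = s" "card Y\<^sub>2 = t"
  shows "graph_iso (X \<union> Y) (block_graph X Y X\<^sub>1 Y\<^sub>2) (M_X n \<union> M_Y m) (M_E n m s t)"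
proof -
  have le: "s \<le> n" "t \<le> m"
    using assms card_mono[of X X\<^sub>1] card_mono[of Y Y\<^sub>2] by auto
  show ?thesis
    unfolding M_E_block_graph[OF le] using assms le
    by (intro block_graph_iso) (auto simp: M_X_def M_Y_def card_image)
qed

section \<open>Perron vector and characteristic equation of a block graph\<close>

context
  fixes X Y X\<^sub>1 Y\<^sub>2 :: "'a set"
  assumes fin: "finite X" "finite Y" and disj: "X \<inter> Y = {}"
    and sub: "X\<^sub>1 \<subseteq> X" "Y\<^sub>2 \<subseteq> Y" and ne: "X - X\<^sub>1 \<noteq> {}" "Y - Y\<^sub>2 \<noteq> {}"
begin

text \<open>The block graph contains the complete bipartite graphs between \<open>X\<close> and
  \<open>Y - Y\<^sub>2\<close> and between \<open>X - X\<^sub>1\<close> and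
  \<open>Y\<close>.\<close>

lemma block_spec_rad:
  "spec_rad (X \<union> Y) (block_graph X Y X\<^sub>1 Y\<^sub>2) > 0"
  "real (card X) * real (card (Y - Y\<^sub>2)) \<le> (spec_rad (X \<union> Y) (block_graph X Y X\<^sub>1 Y\<^sub>2))\<^sup>2"
  "real (card (X - X\<^sub>1)) * real (card Y) \<le> (spec_rad (X \<union> Y) (block_graph X Y X\<^sub>1 Y\<^sub>2))\<^sup>2"
  using fin disj sub ne
    spec_rad_complete_bip[of "X \<union> Y" X "Y - Y\<^sub>2" "block_graph X Y X\<^sub>1 Y\<^sub>2"]
    spec_rad_complete_bip[of "X \<union> Y" "X - X\<^sub>1" Y "block_graph X Y X\<^sub>1 Y\<^sub>2"]
  by (auto simp: block_graph_iff)

lemma block_eigenfun: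
  assumes ef: "eigenfun (X \<union> Y) (block_graph X Y X\<^sub>1 Y\<^sub>2) r f"
  shows "x \<in> X\<^sub>1 \<Longrightarrow> r * f x = sum f (Y - Y\<^sub>2)"
    and "x \<in> X - X\<^sub>1 \<Longrightarrow> r * f x = sum f (Y - Y\<^sub>2) + sum f Y\<^sub>2"
    and "y \<in> Y\<^sub>2 \<Longrightarrow> r * f y = sum f (X - X\<^sub>1)"
    and "y \<in> Y - Y\<^sub>2 \<Longrightarrow> r * f y = sum f (X - X\<^sub>1) + sum f X\<^sub>1"
proof -
  note be = bip_eigenfun[OF bip_block_graph[OF fin disj] ef]
  have splitY: "sum f Y = sum f (Y - Y\<^sub>2) + sum f Y\<^sub>2" and splitX: "sum f X = sum f (X - X\<^sub>1) + sum f X\<^sub>1"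
    using sum.subset_diff[OF sub(2) fin(2)] sum.subset_diff[OF sub(1) fin(1)] by auto
  have adj: "adj (block_graph X Y X\<^sub>1 Y\<^sub>2) x y = of_bool (\<not> (x \<in> X\<^sub>1 \<and> y \<in> Y\<^sub>2))" if "x \<in> X" "y \<in> Y" for x y
    using that disj by (auto simp: adj_def block_graph_iff)
  show "r * f x = sum f (Y - Y\<^sub>2)" if "x \<in> X\<^sub>1" for x
  proof -
    have "r * f x = (\<Sum>y\<in>Y. adj (block_graph X Y X\<^sub>1 Y\<^sub>2) x y * f y)" using be(1)[of x] that sub by auto
    also have "\<dots> = (\<Sum>y\<in>Y - Y\<^sub>2. f y)"
      using fin that sub by (intro sum.mono_neutral_cong_right) (auto simp: adj)
    finally show ?thesis .
  qed
  show "r * f x = sum f (Y - Y\<^sub>2) + sum f Y\<^sub>2" if "x \<in> X - X\<^sub>1" for x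
    using be(1)[of x] that by (simp add: adj splitY[symmetric])
  show "r * f y = sum f (X - X\<^sub>1)" if "y \<in> Y\<^sub>2" for y
  proof -
    have "r * f y = (\<Sum>x\<in>X. adj (block_graph X Y X\<^sub>1 Y\<^sub>2) x y * f x)" using be(2)[of y] that sub by auto
    also have "\<dots> = (\<Sum>x\<in>X - X\<^sub>1. f x)"
      using fin that sub by (intro sum.mono_neutral_cong_right) (auto simp: adj)
    finally show ?thesis .
  qed
  show "r * f y = sum f (X - X\<^sub>1) + sum f X\<^sub>1" if "y \<in> Y - Y\<^sub>2" for y
    using be(2)[of y] that by (simp add: adj splitX[symmetric])
qed

text \<open>Every vertex of \<open>X - X\<^sub>1\<close> is adjacent to all of \<open>Y\<close>, and
  every vertex of \<open>Y - Y\<^sub>2\<close> to all of \<open>X\<close>. Hence a single non-zero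
  value spreads positivity to the whole connected graph.\<close>

lemma block_eigenfun_pos:
  assumes ef: "eigenfun (X \<union> Y) (block_graph X Y X\<^sub>1 Y\<^sub>2) r f" and r: "r > 0"
    and f0: "\<And>v. f v \<ge> 0" and v: "v \<in> X \<union> Y"
  shows "f v > 0"
proof -
  note be = block_eigenfun[OF ef]
  have finS: "finite X\<^sub>1" "finite Y\<^sub>2" using fin sub by (simp_all add: finite_subset)
  have nn: "sum f A \<ge> 0" for A using f0 by (simp add: sum_nonneg)
  have posI: "f v > 0" if "r * f v > 0" for v
    using that r by (simp add: zero_less_mult_iff)
  have X2: "sum f (Y - Y\<^sub>2) + sum f Y\<^sub>2 > 0 \<Longrightarrow> \<forall>x\<in>X - X\<^sub>1. f x > 0"
    using be(2) posI by auto
  have Ypos: "\<forall>y\<in>Y. f y > 0" if "\<forall>x\<in>X - X\<^sub>1. f x > 0"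
  proof -
    have "sum f (X - X\<^sub>1) > 0" using that fin ne by (intro sum_pos) auto
    then have "r * f y > 0" if "y \<in> Y" for y
      using be(3,4)[of y] nn[of X\<^sub>1] that by (cases "y \<in> Y\<^sub>2") auto
    then show ?thesis using posI by auto
  qed
  have Xpos: "\<forall>x\<in>X. f x > 0" if "\<forall>y\<in>Y - Y\<^sub>2. f y > 0"
  proof -
    have "sum f (Y - Y\<^sub>2) > 0" using that fin ne by (intro sum_pos) auto
    then have "r * f x > 0" if "x \<in> X" for x
      using be(1,2)[of x] nn[of Y\<^sub>2] that by (cases "x \<in> X\<^sub>1") auto
    then show ?thesis using posI by auto
  qed
  have mem: "sum f A > 0" if "finite A" "a \<in> A" "f a \<noteq> 0" for A a
    using that f0 by (intro sum_pos2[of A a]) (auto simp: less_le)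
  obtain w where w: "w \<in> X \<union> Y" "f w \<noteq> 0" using ef by (auto simp: eigenfun_def)
  have "\<forall>y\<in>Y. f y > 0"
  proof (cases "w \<in> Y")
    case True
    then have "sum f (Y - Y\<^sub>2) + sum f Y\<^sub>2 > 0"
      using mem[of "Y - Y\<^sub>2" w] mem[of Y\<^sub>2 w] w(2) fin finS nn[of "Y - Y\<^sub>2"] nn[of Y\<^sub>2]
      by (cases "w \<in> Y\<^sub>2") auto
    then show ?thesis using X2 Ypos by blast
  next
    case False
    then have "sum f (X - X\<^sub>1) + sum f X\<^sub>1 > 0"
      using mem[of "X - X\<^sub>1" w] mem[of X\<^sub>1 w] w fin finS nn[of "X - X\<^sub>1"] nn[of X\<^sub>1]
      by (cases "w \<in> X\<^sub>1") auto
    then have "\<forall>y\<in>Y - Y\<^sub>2. f y > 0" using be(4) posI by auto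
    then show ?thesis using Xpos Ypos by blast
  qed
  then show ?thesis using Xpos v by auto
qed

text \<open>A maximiser of the Rayleigh quotient of the subgraph is one of the block graph, hence
  positive, so that no edge can be missing.\<close>

lemma block_graph_rigid:
  assumes E: "E \<subseteq> block_graph X Y X\<^sub>1 Y\<^sub>2"
    and rho: "spec_rad (X \<union> Y) E \<ge> spec_rad (X \<union> Y) (block_graph X Y X\<^sub>1 Y\<^sub>2)"
  shows "E = block_graph X Y X\<^sub>1 Y\<^sub>2"
proof -
  let ?V = "X \<union> Y" and ?B = "block_graph X Y X\<^sub>1 Y\<^sub>2"
  have V: "finite ?V" "?V \<noteq> {}" using fin ne by auto
  have eq: "spec_rad ?V E = spec_rad ?V ?B"
    using rho spec_rad_mono[OF V E] by simp
  obtain f where f: "eigenfun ?V E (spec_rad ?V ?B) f" "\<And>v. f v \<ge> 0"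
    using spec_rad_Rayleigh(2)[OF V, of E] eq by auto
  note ray = spec_rad_Rayleigh(1)[OF V, of ?B]
  \<comment> \<open>The form of \<open>E\<close> at \<open>f\<close> already equals the upper bound
    valid for the block graph, and adding edges does not lower it, so \<open>f\<close> attains the
    maximum for both graphs.\<close>
  have Qeq: "qform ?V ?B f = qform ?V E f" "qform ?V ?B f = spec_rad ?V ?B * (\<Sum>v\<in>?V. (f v)\<^sup>2)"
    using qform_eigenfun[OF f(1)] ray[of f] qform_mono[OF E, of f ?V] f(2) by auto
  have "eigenfun ?V ?B (spec_rad ?V ?B) f"
    using maximiser_eigenvector[OF V(1) ray Qeq(2)] f(1) by (simp add: eigenfun_def)
  then have pos: "f v > 0" if "v \<in> ?V" for v
    by (rule block_eigenfun_pos[OF _ block_spec_rad(1) f(2) that])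
  have "{x, y} \<in> E" if xy: "x \<in> X" "y \<in> Y" "{x, y} \<in> ?B" for x y
  proof (rule ccontr)
    assume "{x, y} \<notin> E"
    have term_le: "adj E v u * f v * f u \<le> adj ?B v u * f v * f u" for v u
      using f(2) by (intro mult_right_mono adj_mono[OF E]) auto
    have "(\<Sum>u\<in>?V. adj E x u * f x * f u) < (\<Sum>u\<in>?V. adj ?B x u * f x * f u)"
    proof (rule sum_strict_mono_ex1)
      show "\<exists>u\<in>?V. adj E x u * f x * f u < adj ?B x u * f x * f u"
        using xy \<open>{x, y} \<notin> E\<close> pos by (intro bexI[of _ y]) (auto simp: adj_def)
    qed (use V term_le in auto)
    then have "qform ?V E f < qform ?V ?B f"
      unfolding qform_def using V xy term_le
      by (intro sum_strict_mono_ex1) (auto intro: sum_mono)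
    then show False using Qeq by simp
  qed
  then show ?thesis using E by (auto simp: block_graph_def)
qed

text \<open>Summing the eigenvalue equations over the four blocks gives a linear system for the
  block sums. Eliminating the two sums over \<open>X\<close> leaves two equations for
  \<open>\<gamma>\<close> and \<open>\<delta>\<close>, and the polynomial is their
  determinant.\<close>

lemma block_spec_rad_quadratic:
  fixes s t n m :: real
  assumes "s = card X\<^sub>1" "n = card X" "t = card Y\<^sub>2" "m = card Y"
    and \<theta>: "\<theta> = (spec_rad (X \<union> Y) (block_graph X Y X\<^sub>1 Y\<^sub>2))\<^sup>2"
  shows "\<theta>\<^sup>2 - (n * m - s * t) * \<theta> + s * (n - s) * t * (m - t) = 0"
proof -
  let ?V = "X \<union> Y" and ?B = "block_graph X Y X\<^sub>1 Y\<^sub>2"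
  define r where "r = spec_rad ?V ?B"
  have r: "r > 0" unfolding r_def by (rule block_spec_rad)
  have \<theta>r: "\<theta> = r * r" by (simp add: \<theta> r_def power2_eq_square)
  have V: "finite ?V" "?V \<noteq> {}" using fin ne by auto
  obtain f where f: "eigenfun ?V ?B r f" "\<And>v. f v \<ge> 0"
    using spec_rad_Rayleigh(2)[OF V, of ?B] by (auto simp: r_def)
  note be = block_eigenfun[OF f(1)]
  define \<alpha> where "\<alpha> = sum f X\<^sub>1"
  define \<beta> where "\<beta> = sum f (X - X\<^sub>1)"
  define \<gamma> where "\<gamma> = sum f (Y - Y\<^sub>2)"
  define \<delta> where "\<delta> = sum f Y\<^sub>2"
  have finS: "finite X\<^sub>1" "finite Y\<^sub>2" using fin sub by (simp_all add: finite_subset)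
  have cX: "real (card (X - X\<^sub>1)) = n - s" and cY: "real (card (Y - Y\<^sub>2)) = m - t"
    using assms sub fin finS by (simp_all add: card_Diff_subset card_mono of_nat_diff)
  have \<alpha>: "r * \<alpha> = s * \<gamma>"
    unfolding \<alpha>_def sum_distrib_left using be(1) by (simp add: \<gamma>_def assms)
  have \<beta>: "r * \<beta> = (n - s) * (\<gamma> + \<delta>)"
    unfolding \<beta>_def sum_distrib_left using be(2) by (simp add: \<gamma>_def \<delta>_def cX)
  have \<gamma>: "r * \<gamma> = (m - t) * (\<beta> + \<alpha>)"
    unfolding \<gamma>_def sum_distrib_left using be(4) by (simp add: \<alpha>_def \<beta>_def cY)
  have \<delta>: "r * \<delta> = t * \<beta>"
    unfolding \<delta>_def sum_distrib_left using be(3) by (simp add: \<beta>_def assms)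
  have \<theta>\<gamma>: "\<theta> * \<gamma> = (m - t) * (n * \<gamma> + (n - s) * \<delta>)"
  proof -
    have "\<theta> * \<gamma> = r * ((m - t) * (\<beta> + \<alpha>))" by (simp only: \<theta>r mult.assoc \<gamma>)
    also have "\<dots> = (m - t) * (r * \<beta> + r * \<alpha>)" by (simp add: algebra_simps)
    finally have "\<theta> * \<gamma> = (m - t) * (r * \<beta> + r * \<alpha>)" .
    then show ?thesis unfolding \<alpha> \<beta> by (simp add: algebra_simps)
  qed
  have \<theta>\<delta>: "\<theta> * \<delta> = t * (n - s) * (\<gamma> + \<delta>)"
  proof -
    have "\<theta> * \<delta> = r * (t * \<beta>)" by (simp only: \<theta>r mult.assoc \<delta>)
    then have "\<theta> * \<delta> = t * (r * \<beta>)" by simp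
    then show ?thesis unfolding \<beta> by (simp add: algebra_simps)
  qed
  have "\<gamma> \<ge> 0" "\<delta> \<ge> 0" unfolding \<gamma>_def \<delta>_def using f(2) by (auto intro: sum_nonneg)
  have "\<gamma> > 0"
    unfolding \<gamma>_def using block_eigenfun_pos[OF f(1) r f(2)] fin ne by (intro sum_pos) auto
  \<comment> \<open>The determinant is multiplied by \<open>\<gamma>\<close> and the two equations
    are substituted; as \<open>\<gamma> > 0\<close>, the determinant itself vanishes.\<close>
  have "(\<theta>\<^sup>2 - (n * m - s * t) * \<theta> + s * (n - s) * t * (m - t)) * \<gamma>
      = (\<theta> - t * (n - s)) * (\<theta> * \<gamma> - (m - t) * n * \<gamma>) - (m - t) * (n - s) * (t * (n - s) * \<gamma>)"
    by (simp add: power2_eq_square algebra_simps)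
  also have "\<theta> * \<gamma> - (m - t) * n * \<gamma> = (m - t) * (n - s) * \<delta>"
    unfolding \<theta>\<gamma> by (simp add: algebra_simps)
  also have "t * (n - s) * \<gamma> = \<theta> * \<delta> - t * (n - s) * \<delta>"
    unfolding \<theta>\<delta> by (simp add: algebra_simps)
  also have "(\<theta> - t * (n - s)) * ((m - t) * (n - s) * \<delta>) - (m - t) * (n - s) * (\<theta> * \<delta> - t * (n - s) * \<delta>) = 0"
    by (simp add: algebra_simps)
  finally show ?thesis using \<open>\<gamma> > 0\<close> by simp
qed

end

section \<open>Graphs that are not Hamilton-biconnected\<close>

lemma M_spec_rad:
  assumes st: "s < n" "t < m" and r: "r = spec_rad (M_X n \<union> M_Y m) (M_E n m s t)"
  shows "r > 0" "real (n * (m - t)) \<le> r\<^sup>2" "real ((n - s) * m) \<le> r\<^sup>2"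
    "(r\<^sup>2)\<^sup>2 - (real n * m - real s * t) * r\<^sup>2 + real s * (real n - s) * t * (real m - t) = 0"
proof -
  let ?X\<^sub>1 = "Inl ` {..<s} :: (nat + nat) set" and ?Y\<^sub>2 = "Inr ` {m - t..<m} :: (nat + nat) set"
  have fin: "finite (M_X n)" "finite (M_Y m)" and disj: "M_X n \<inter> M_Y m = {}"
    and sub: "?X\<^sub>1 \<subseteq> M_X n" "?Y\<^sub>2 \<subseteq> M_Y m"
    using st by (auto simp: M_X_def M_Y_def)
  have card: "card (M_X n) = n" "card (M_Y m) = m" "card ?X\<^sub>1 = s" "card ?Y\<^sub>2 = t"
    using st by (auto simp: M_X_def M_Y_def card_image)
  have cd: "card (M_X n - ?X\<^sub>1) = n - s" "card (M_Y m - ?Y\<^sub>2) = m - t"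
    using card sub by (simp_all add: card_Diff_subset)
  then have ne: "M_X n - ?X\<^sub>1 \<noteq> {}" "M_Y m - ?Y\<^sub>2 \<noteq> {}"
    using st by force+
  have r': "r = spec_rad (M_X n \<union> M_Y m) (block_graph (M_X n) (M_Y m) ?X\<^sub>1 ?Y\<^sub>2)"
    using st by (simp add: r M_E_block_graph)
  note a = fin disj sub ne
  show "r > 0" unfolding r' by (rule block_spec_rad[OF a])
  show "real (n * (m - t)) \<le> r\<^sup>2" using block_spec_rad(2)[OF a] by (simp add: r' card cd)
  show "real ((n - s) * m) \<le> r\<^sup>2" using block_spec_rad(3)[OF a] by (simp add: r' card cd)
  show "(r\<^sup>2)\<^sup>2 - (real n * m - real s * t) * r\<^sup>2 + real s * (real n - s) * t * (real m - t) = 0"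
    by (rule block_spec_rad_quadratic[OF a]) (simp_all add: card r')
qed

text \<open>\<open>non_ham_structure\<close> is applied to \<open>G\<close> without
  \<open>W\<close>, extended by the artificial vertex labelled \<open>u\<close>. Restoring
  \<open>W\<close> raises degrees by at most \<open>p\<close>. Pairs at the artificial vertex are
  not pairs of \<open>G\<close>, hence the \<open>- 1\<close> in the counts and the sets
  \<open>B - {u}\<close>.\<close>

theorem non_biconnected_structure:
  fixes X Y :: "'a set"
  assumes bip: "bip_graph X Y E" and card: "card X = n" "card Y + 1 = n"
    and non: "\<not> ham_biconnected_2p p X Y E"
    and \<nu>: "\<nu> = nonedges X Y (\<lambda>x y. {x, y} \<in> E)" and N: "N = n - p"
  obtains a b A B u where "u \<in> X" "a + b \<le> N" "A \<subseteq> X" "A \<noteq> {}" "card A = N - b"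
    "B \<subseteq> insert u Y" "B \<noteq> {}" "card B = N - a"
    "\<And>x. x \<in> A \<Longrightarrow> degree E x \<le> a + p" "\<And>y. y \<in> B - {u} \<Longrightarrow> degree E y \<le> b + p"
    "u \<in> B \<Longrightarrow> 2 \<le> b"
    "(N - a - 1) * (N - b) \<le> \<nu>" "u \<notin> B \<Longrightarrow> (N - a) * (N - b) \<le> \<nu>"
    "a + b = N \<Longrightarrow> u \<in> B \<Longrightarrow>
       (N - a - 1) * (N - b) + (a - 1) \<le> \<nu> \<or> (\<forall>x\<in>A. \<forall>y\<in>B - {u}. {x, y} \<notin> E)"
proof -
  have fin: "finite X" "finite Y" and disj: "X \<inter> Y = {}" using bip by (auto simp: bip_graph_def)
  obtain W u v where W: "W \<subseteq> X \<union> Y" "card (W \<inter> X) = card (W \<inter> Y)" "card W = 2 * p"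
    and uv: "u \<in> X - W" "v \<in> X - W" "u \<noteq> v"
    and nopath: "\<not> ham_path ((X - W) \<union> (Y - W)) (del_edges E W) u v"
    using non unfolding ham_biconnected_2p_def ham_biconnected_def balanced_set_def by blast
  have "card W = card (W \<inter> X) + card (W \<inter> Y)"
    using W(1) fin disj by (subst card_Un_disjoint[symmetric]) (auto intro!: arg_cong[where f = card])
  then have cW: "card (W \<inter> X) = p" "card (W \<inter> Y) = p" using W by auto
  define X' where "X' = X - W"
  define Y' where "Y' = Y - W"
  define Z where "Z = insert u Y'"
  define R where "R x z = (if z = u then x = u \<or> x = v else {x, z} \<in> del_edges E W)" for x z
  have cX': "card X' = N"
    using cW card fin card_Diff_subset_Int[of X W] by (simp add: X'_def N Int_commute)
  have cY': "card Y' = card Y - p"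
    using cW card fin card_Diff_subset_Int[of Y W] by (simp add: Y'_def Int_commute)
  have finX': "finite X'" "finite Y'" "finite Z" using fin by (auto simp: X'_def Y'_def Z_def)
  have uY: "u \<notin> Y" using uv disj by auto
  have "card {u, v} \<le> card X'" using uv finX' by (intro card_mono) (auto simp: X'_def)
  then have N2: "N \<ge> 2" using uv cX' by simp
  have cZ: "card Z = N"
    using uY finX' cY' card N N2 by (simp add: Z_def Y'_def)
  have "\<not> ham_cyc X' Z R"
  proof
    assume "ham_cyc X' Z R"
    then have "ham_path (X' \<union> Y') (del_edges E W) u v"
      using uv disj finX' unfolding R_def[abs_def] Z_def
      by (intro ham_path_of_ham_cyc) (auto simp: X'_def Y'_def)
    then show False using nopath by (simp add: X'_def Y'_def)
  qed
  then obtain a b A B where ab: "a + b \<le> N" and A: "A \<subseteq> X'" "A \<noteq> {}" "card A = N - b"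
    and B: "B \<subseteq> Z" "B \<noteq> {}" "card B = N - a"
    and dA: "\<And>x. x \<in> A \<Longrightarrow> card {z\<in>Z. R x z} \<le> a" and dB: "\<And>z. z \<in> B \<Longrightarrow> card {x\<in>X'. R x z} \<le> b"
    and last: "\<And>y. a + b = N \<Longrightarrow> y \<in> B \<Longrightarrow>
       (N - a - 1) * (N - b) + (a - 1) \<le> nonedges X' (Z - {y}) R \<or> (\<forall>x\<in>A. \<forall>z\<in>B. \<not> R x z)"
    by (rule non_ham_structure[OF finX'(1,3) cX' cZ N2]) (rule that)
  have Zu: "Z - {u} = Y'" using uY by (auto simp: Z_def Y'_def)
  have RE: "R x y \<longleftrightarrow> {x, y} \<in> E" if "x \<in> X'" "y \<in> Y'" for x y
    using that uY by (auto simp: R_def X'_def Y'_def del_edges_def)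
  have \<nu>R: "nonedges X' (Z - {u}) R \<le> \<nu>"
    unfolding \<nu> Zu using fin RE by (intro nonedges_mono) (auto simp: X'_def Y'_def)
  have degA: "degree E x \<le> a + p" if x: "x \<in> A" for x
  proof -
    have xX: "x \<in> X'" using x A by auto
    have "degree E x = card {y\<in>Y. {x, y} \<in> E}"
      using bip_degree(1)[OF bip] xX by (simp add: X'_def)
    also have "\<dots> \<le> card ({z\<in>Z. R x z} \<union> W \<inter> Y)"
      using finX' fin xX RE by (intro card_mono) (auto simp: Z_def Y'_def)
    also have "\<dots> \<le> card {z\<in>Z. R x z} + card (W \<inter> Y)" by (rule card_Un_le)
    finally show ?thesis using dA[OF x] cW by simp
  qed
  have degB: "degree E y \<le> b + p" if y: "y \<in> B - {u}" for y
  proof -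
    have yY: "y \<in> Y'" using y B Zu by auto
    have "degree E y = card {x\<in>X. {x, y} \<in> E}"
      using bip_degree(2)[OF bip] yY by (simp add: Y'_def)
    also have "\<dots> \<le> card ({x\<in>X'. R x y} \<union> W \<inter> X)"
      using finX' fin yY RE by (intro card_mono) (auto simp: X'_def)
    also have "\<dots> \<le> card {x\<in>X'. R x y} + card (W \<inter> X)" by (rule card_Un_le)
    finally show ?thesis using dB y cW by fastforce
  qed
  show thesis
  proof (rule that)
    show "u \<in> X" using uv by simp
    show "a + b \<le> N" "A \<noteq> {}" "card A = N - b" "B \<noteq> {}" "card B = N - a" by fact+
    show "A \<subseteq> X" "B \<subseteq> insert u Y" using A B by (auto simp: X'_def Y'_def Z_def)
    show "\<And>x. x \<in> A \<Longrightarrow> degree E x \<le> a + p" "\<And>y. y \<in> B - {u} \<Longrightarrow> degree E y \<le> b + p" by fact+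
    \<comment> \<open>The artificial vertex has exactly the neighbours \<open>u\<close> and
      \<open>v\<close>.\<close>
    show "2 \<le> b" if "u \<in> B"
    proof -
      have "{x\<in>X'. R x u} = {u, v}" using uv by (auto simp: R_def X'_def)
      then show ?thesis using dB[OF that] uv by simp
    qed
    show "(N - a - 1) * (N - b) \<le> \<nu>"
    proof -
      \<comment> \<open>Each vertex of \<open>A\<close> has at least \<open>N - a\<close>
        non-neighbours in \<open>Z\<close>, at most one of them artificial.\<close>
      have "card A * (N - a - 1) \<le> nonedges X' (Z - {u}) R"
      proof (rule nonedges_ge_left)
        fix x assume "x \<in> A"
        then have "N - a \<le> card {z\<in>Z. \<not> R x z}"
          using card_filter_compl[OF finX'(3), of "R x"] dA[of x] cZ by linarith
        moreover have "card {z\<in>Z. \<not> R x z} - 1 \<le> card ({z\<in>Z. \<not> R x z} - {u})"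
          using diff_card_le_card_Diff[of "{u}" "{z\<in>Z. \<not> R x z}"] by simp
        moreover have "{z\<in>Z. \<not> R x z} - {u} = {z\<in>Z - {u}. \<not> R x z}" by auto
        ultimately show "N - a - 1 \<le> card {z\<in>Z - {u}. \<not> R x z}" by simp
      qed (use finX' A in auto)
      then show ?thesis using \<nu>R A(3) by (simp add: mult.commute)
    qed
    show "(N - a) * (N - b) \<le> \<nu>" if "u \<notin> B"
    proof -
      have "card B * (N - b) \<le> nonedges X' (Z - {u}) R"
      proof (rule nonedges_ge_right)
        fix z assume "z \<in> B"
        then show "N - b \<le> card {x\<in>X'. \<not> R x z}"
          using card_filter_compl[OF finX'(1), of "\<lambda>x. R x z"] dB[of z] cX' by linarith
      qed (use finX' B that in auto)
      then show ?thesis using \<nu>R B(3) by simp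
    qed
    show "(N - a - 1) * (N - b) + (a - 1) \<le> \<nu> \<or> (\<forall>x\<in>A. \<forall>y\<in>B - {u}. {x, y} \<notin> E)"
      if "a + b = N" "u \<in> B"
    proof -
      have "{x, y} \<notin> E" if "\<not> R x y" "x \<in> A" "y \<in> B - {u}" for x y
        using RE[of x y] that A(1) B(1) Zu by blast
      then show ?thesis using last[OF that] \<nu>R by fastforce
    qed
  qed
qed

text \<open>\<open>(b - 1) * (N - b)\<close> is concave in \<open>b\<close> and takes the value
  \<open>q * (N - q - 1)\<close> at both ends \<open>q + 1\<close> and \<open>N - q\<close> of the
  range.\<close>

lemma product_lower_bound:
  fixes q b N :: nat
  assumes "q + 1 \<le> b" "b + q \<le> N"
  shows "q * (N - q - 1) \<le> (b - 1) * (N - b)"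
proof -
  obtain i where i: "b = q + 1 + i" using assms(1) le_Suc_ex by blast
  obtain j where j: "N = b + q + j" using assms(2) le_Suc_ex by blast
  have "q * (q + i + j) \<le> (q + i) * (q + j)" by (simp add: algebra_simps)
  then show ?thesis by (simp add: i j algebra_simps)
qed

text \<open>With \<open>z = \<rho>\<^sup>2 - e\<close>, the two numerical facts contradict \<open>bip_spec_rad_bound\<close>.\<close>

lemma arith_many_nonedges:
  fixes n k q z \<nu> :: real
  assumes q: "2 \<le> q" "q \<le> k" and n: "2 * n \<ge> (k + 2) * (q + 1)"
    and \<nu>: "\<nu> \<ge> q * (n - k - 1)" and z: "z \<ge> \<nu> - n * (q - 1)"
  shows "z + k * (n - 1) \<ge> 0" "(z + k * (n - 1)) * (z + k * n) > k\<^sup>2 * (z + (n * (n - 1) - \<nu>))"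
proof -
  \<comment> \<open>\<open>- c\<close> is the value of \<open>n - q * (k + 1)\<close>, a lower bound
    for \<open>z\<close>, at the smallest \<open>n\<close> that the hypothesis allows.\<close>
  define c where "c = (q * k - k - 2) / 2"
  have "z \<ge> n - q * (k + 1)" using \<nu> z by (simp add: algebra_simps)
  moreover have "(k + 2) * (q + 1) - 2 * (q * (k + 1)) = - (2 * c)"
    by (simp add: c_def field_simps)
  moreover have "z \<ge> - c" if "z \<ge> n - w" "d - 2 * w = - (2 * c)" "2 * n \<ge> d" for w d
    using that by linarith
  ultimately have zc: "z \<ge> - c" using n by blast
  have kq: "k * q \<ge> 2 * k" "k * q \<ge> 2 * q"
    using q mult_left_mono[of 2 q k] mult_right_mono[of 2 k q] by auto
  have n2: "2 * n \<ge> 4 * (q + 1)" "2 * n \<ge> 3 * (k + 2)"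
    using n q mult_right_mono[of 4 "k + 2" "q + 1"] mult_left_mono[of 3 "q + 1" "k + 2"] by (auto simp: algebra_simps)
  have "k * (n - 1) \<ge> k * q" using q n2 by (intro mult_left_mono) auto
  moreover have "2 * c = k * q - k - 2" by (simp add: c_def)
  then have "k * q \<ge> c" using kq(1) q by linarith
  ultimately show "z + k * (n - 1) \<ge> 0" using zc by linarith
  \<comment> \<open>The two sides of the second claim differ by
    \<open>z\<^sup>2 + k * ((2 * n - 1 - k) * z + k * \<nu>)\<close>; the inner bracket is shown
    positive by inserting the lower bounds for \<open>z\<close>, \<open>\<nu>\<close> and
    \<open>n\<close>.\<close>
  have "(2 * n - 1 - k) * z \<ge> (2 * n - 1 - k) * - c" using zc n2 q by (intro mult_left_mono) auto
  moreover have "k * \<nu> \<ge> k * (q * (n - k - 1))" using \<nu> q by (intro mult_left_mono) auto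
  moreover have "(2 * n - 1 - k) * - c + k * (q * (n - k - 1)) = n * (k + 2) - (k + 1) * (q * k + k + 2) / 2"
    by (simp add: c_def field_simps)
  moreover have "n * (k + 2) * 2 \<ge> ((k + 2) * (q + 1)) * (k + 2)"
    using mult_right_mono[OF n, of "k + 2"] q by (simp add: algebra_simps)
  moreover have "((k + 2) * (q + 1)) * (k + 2) - (k + 1) * (q * k + k + 2) = 3 * (k * q) + 4 * q + k + 2"
    by (simp add: algebra_simps)
  ultimately have "(2 * n - 1 - k) * z + k * \<nu> > 0" using q kq by linarith
  then have "z\<^sup>2 + k * ((2 * n - 1 - k) * z + k * \<nu>) > 0"
    using q by (intro add_nonneg_pos) auto
  then show "(z + k * (n - 1)) * (z + k * n) > k\<^sup>2 * (z + (n * (n - 1) - \<nu>))"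
    by (simp add: algebra_simps power2_eq_square)
qed

text \<open>The bound on the spectral radius is the one from the complete bipartite subgraph of
  \<open>M\<close> with sides \<open>n\<close> and \<open>n - q\<close>. More missing edges would
  make the edge number so small that \<open>bip_spec_rad_bound\<close> is violated.\<close>

lemma few_nonedges_ii:
  assumes bip: "bip_graph X Y E" and card: "card X = n" "card Y + 1 = n"
    and deg: "min_degree_ge (X \<union> Y) E k"
    and q: "2 \<le> q" "q \<le> k" and n: "2 * n \<ge> (k + 2) * (q + 1)"
    and r: "spec_rad (X \<union> Y) E > 0" "real (n * (n - q)) \<le> (spec_rad (X \<union> Y) E)\<^sup>2"
  shows "nonedges X Y (\<lambda>x y. {x, y} \<in> E) < q * (n - k - 1)"
proof (rule ccontr)
  define \<nu> where "\<nu> = nonedges X Y (\<lambda>x y. {x, y} \<in> E)"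
  assume "\<not> ?thesis"
  then have \<nu>: "\<nu> \<ge> q * (n - k - 1)" by (simp add: \<nu>_def)
  define r where "r = spec_rad (X \<union> Y) E"
  define e where "e = real (card X * card Y) - real \<nu>"
  have "(k + 2) * 3 \<le> (k + 2) * (q + 1)" using q by (intro mult_le_mono) auto
  then have nk: "n \<ge> k + 1" "n \<ge> q" "n \<ge> 1" using n q by auto
  have cY: "real (card Y) = real n - 1" using card by auto
  have e': "e = real n * (real n - 1) - \<nu>" by (simp add: e_def card cY)
  have ne: "X \<union> Y \<noteq> {}" using card nk by auto
  have "real n * (real n - real q) \<le> r\<^sup>2" using r nk by (simp add: r_def of_nat_diff)
  then have z: "r\<^sup>2 - e \<ge> real \<nu> - real n * (real q - 1)" by (simp add: e' algebra_simps)
  have "real \<nu> \<ge> real (q * (n - k - 1))" using \<nu> by (rule of_nat_mono)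
  moreover have "real (n - k - 1) = real n - real k - 1" using nk by linarith
  ultimately have \<nu>': "real \<nu> \<ge> real q * (real n - real k - 1)" by (simp only: of_nat_mult)
  have "real (2 * n) \<ge> real ((k + 2) * (q + 1))" using n by (rule of_nat_mono)
  then have n': "2 * real n \<ge> (real k + 2) * (real q + 1)" by (simp add: algebra_simps)
  note ar = arith_many_nonedges[OF _ _ n' \<nu>' z]
  have "(r\<^sup>2 - e + real k * card Y) * (r\<^sup>2 - e + real k * card X) \<le> (real k)\<^sup>2 * r\<^sup>2"
  proof (rule bip_spec_rad_bound[OF bip deg ne r_def])
    show "r\<^sup>2 - e + real k * card Y \<ge> 0" using ar(1) q by (simp add: cY)
  qed (simp_all only: r_def r(1) e_def \<nu>_def)
  moreover have "r\<^sup>2 - e + (real n * (real n - 1) - \<nu>) = r\<^sup>2" by (simp add: e')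
  ultimately show False using ar(2) q by (simp add: cY card)
qed

text \<open>With at least \<open>n - 1\<close> missing edges, \<open>e\<close> is at most
  \<open>(n - 1)\<^sup>2\<close>, so \<open>r\<^sup>2 - e\<close> is nonnegative, and
  \<open>bip_spec_rad_bound\<close> would be violated.\<close>

lemma few_nonedges_i:
  assumes bip: "bip_graph X Y E" and card: "card X = n" "card Y + 1 = n"
    and deg: "min_degree_ge (X \<union> Y) E k" and k: "1 \<le> k" and n: "2 \<le> n"
    and r: "spec_rad (X \<union> Y) E > 0" "real ((n - 1) * (n - 1)) \<le> (spec_rad (X \<union> Y) E)\<^sup>2"
  shows "nonedges X Y (\<lambda>x y. {x, y} \<in> E) < n - 1"
proof (rule ccontr)
  define \<nu> where "\<nu> = nonedges X Y (\<lambda>x y. {x, y} \<in> E)"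
  assume "\<not> ?thesis"
  then have \<nu>: "\<nu> \<ge> n - 1" by (simp add: \<nu>_def)
  define r where "r = spec_rad (X \<union> Y) E"
  define e where "e = real (card X * card Y) - real \<nu>"
  have cY: "real (card Y) = real n - 1" using card by auto
  have e': "e = real n * (real n - 1) - \<nu>" by (simp add: e_def card cY)
  have ne: "X \<union> Y \<noteq> {}" using card n by auto
  have \<nu>': "real \<nu> \<ge> real n - 1" using \<nu> n by linarith
  have "(real n - 1) * (real n - 1) \<le> r\<^sup>2" using r n by (simp add: r_def of_nat_diff)
  then have z: "r\<^sup>2 - e \<ge> 0" using \<nu>' by (simp add: e' algebra_simps)
  have "(r\<^sup>2 - e + real k * card Y) * (r\<^sup>2 - e + real k * card X) \<le> (real k)\<^sup>2 * r\<^sup>2"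
  proof (rule bip_spec_rad_bound[OF bip deg ne r_def])
    show "r\<^sup>2 - e + real k * card Y \<ge> 0" using z by simp
  qed (simp_all only: r_def r(1) e_def \<nu>_def)
  moreover have "(r\<^sup>2 - e + real k * card Y) * (r\<^sup>2 - e + real k * card X) - (real k)\<^sup>2 * r\<^sup>2
      = (r\<^sup>2 - e)\<^sup>2 + real k * ((2 * real n - 1 - real k) * (r\<^sup>2 - e) + real k * \<nu>)"
    unfolding cY card e' by (simp add: algebra_simps power2_eq_square)
  \<comment> \<open>A vertex of \<open>Y\<close> has at least \<open>k\<close> neighbours among the
    \<open>n\<close> vertices of \<open>X\<close>; this keeps the coefficient
    \<open>2 * n - 1 - k\<close> nonnegative.\<close>
  moreover have "real k \<le> real n"
  proof -
    have "Y \<noteq> {}" using card n by auto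
    then obtain y where "y \<in> Y" by blast
    then have "k \<le> card {x\<in>X. {x, y} \<in> E}"
      using deg by (simp add: min_degree_ge_def bip_degree(2)[OF bip, symmetric])
    also have "\<dots> \<le> n" using bip unfolding card(1)[symmetric] by (intro card_mono) (auto simp: bip_graph_def)
    finally show ?thesis by simp
  qed
  then have "(2 * real n - 1 - real k) * (r\<^sup>2 - e) \<ge> 0" using z n by (intro mult_nonneg_nonneg) auto
  then have "real k * ((2 * real n - 1 - real k) * (r\<^sup>2 - e) + real k * \<nu>) > 0"
    using k \<nu> n by (intro mult_pos_pos add_nonneg_pos) auto
  ultimately show False using zero_le_power2[of "r\<^sup>2 - e"] by linarith
qed

text \<open>The quadratic equations for the block graph containing \<open>G\<close> and for the extremal graph
  have the same linear coefficient; only the constant terms differ.\<close>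

lemma low_degree_small_side:
  assumes bip: "bip_graph X Y E" and card: "card X = n" "card Y + 1 = n"
    and k: "1 \<le> k" "2 * k + 3 \<le> n" and y: "y \<in> Y" "degree E y \<le> k + 1"
  shows "spec_rad (X \<union> Y) E < spec_rad (M_X n \<union> M_Y (n - 1)) (M_E n (n - 1) 1 (n - k - 1))"
proof (rule ccontr)
  define r where "r = spec_rad (M_X n \<union> M_Y (n - 1)) (M_E n (n - 1) 1 (n - k - 1))"
  assume "\<not> ?thesis"
  then have ge: "r \<le> spec_rad (X \<union> Y) E" by (simp add: r_def)
  have fin: "finite X" "finite Y" and disj: "X \<inter> Y = {}" using bip by (auto simp: bip_graph_def)
  have "card {x\<in>X. {x, y} \<in> E} + card {x\<in>X. {x, y} \<notin> E} = n"
    using card_filter_compl[OF fin(1), of "\<lambda>x. {x, y} \<in> E"] card by simp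
  then have "n - k - 1 \<le> card {x\<in>X. {x, y} \<notin> E}" using y bip_degree(2)[OF bip y(1)] by simp
  \<comment> \<open>The empty block has \<open>n - k - 1\<close> vertices in \<open>X\<close>
    against one in \<open>Y\<close>; in the extremal graph these two sizes are exchanged.\<close>
  then obtain X\<^sub>1 where X1: "X\<^sub>1 \<subseteq> {x\<in>X. {x, y} \<notin> E}" "card X\<^sub>1 = n - k - 1"
    by (rule obtain_subset_with_card_n)
  have sub: "X\<^sub>1 \<subseteq> X" "{y} \<subseteq> Y" using X1 y by auto
  have E: "E \<subseteq> block_graph X Y X\<^sub>1 {y}" using X1 by (intro subset_block_graphI[OF bip]) auto
  have ne: "X - X\<^sub>1 \<noteq> {}" "Y - {y} \<noteq> {}"
  proof -
    have "card X\<^sub>1 < card X" using X1 card k by simp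
    then show "X - X\<^sub>1 \<noteq> {}" using sub by auto
    have "Y \<noteq> {y}" using card k by auto
    then show "Y - {y} \<noteq> {}" using sub by blast
  qed
  define r' where "r' = spec_rad (X \<union> Y) (block_graph X Y X\<^sub>1 {y})"
  have "spec_rad (X \<union> Y) E \<le> r'" unfolding r'_def using fin y E by (intro spec_rad_mono) auto
  then have rr: "r \<le> r'" using ge by simp
  define m where "m = real n"
  define l where "l = real k"
  have l: "l \<ge> 1" "m \<ge> 2 * l + 3" using k by (auto simp: l_def m_def)
  have nr: "real (n - k - 1) = m - l - 1" "real (n - 1) = m - 1" "real (card Y) = m - 1"
    using k card by (auto simp: l_def m_def of_nat_diff)
  have st: "1 < n" "n - k - 1 < n - 1" using k by auto
  note M = M_spec_rad[OF st r_def]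
  have q1: "(r\<^sup>2)\<^sup>2 - (m * (m - 1) - (m - l - 1)) * r\<^sup>2 + (m - 1) * (m - l - 1) * l = 0"
    using M(4) unfolding nr m_def[symmetric] by (simp add: algebra_simps)
  have low: "r\<^sup>2 \<ge> (m - 1) * (m - 1)" using M(3) by (simp only: of_nat_mult nr)
  have q2: "(r'\<^sup>2)\<^sup>2 - (m * (m - 1) - (m - l - 1)) * r'\<^sup>2 + (m - l - 1) * (l + 1) * (m - 2) = 0"
    using block_spec_rad_quadratic[OF fin disj sub ne refl refl refl refl r'_def[THEN arg_cong[where f = "\<lambda>r. r\<^sup>2"]]]
    unfolding nr X1(2) card(1) m_def[symmetric] by (simp add: algebra_simps)
  have le: "r\<^sup>2 \<le> r'\<^sup>2" using rr M(1) by (intro power_mono) auto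
  \<comment> \<open>Difference of the two quadratic equations: the right side is negative, but both
    factors on the left turn out nonnegative.\<close>
  have "(r'\<^sup>2 - r\<^sup>2) * (r'\<^sup>2 + r\<^sup>2 - (m * (m - 1) - (m - l - 1))) = - ((m - l - 1) * (m - l - 2))"
    using q1 q2 by (simp add: algebra_simps power2_eq_square)
  moreover have "(m - l - 1) * (m - l - 2) > 0" using l by (intro mult_pos_pos) auto
  moreover have "r'\<^sup>2 + r\<^sup>2 - (m * (m - 1) - (m - l - 1)) \<ge> 0"
  proof -
    have "(m - 1) * (m - 1) \<ge> (m - 1) * 1" using l by (intro mult_left_mono) auto
    then show ?thesis using low le l by (simp add: algebra_simps)
  qed
  then have "(r'\<^sup>2 - r\<^sup>2) * (r'\<^sup>2 + r\<^sup>2 - (m * (m - 1) - (m - l - 1))) \<ge> 0"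
    using le by (intro mult_nonneg_nonneg) auto
  ultimately show False by linarith
qed

text \<open>An empty block embeds \<open>G\<close> into a block graph isomorphic to
  \<open>M\<close>, and rigidity then excludes any further missing edge.\<close>

lemma extremal_iso:
  assumes bip: "bip_graph X Y E" and card: "card X = n" "card Y = m"
    and sub: "X\<^sub>1 \<subseteq> X" "Y\<^sub>2 \<subseteq> Y" "card X\<^sub>1 = s" "card Y\<^sub>2 = t" "s < n" "t < m"
    and no: "\<And>x y. x \<in> X\<^sub>1 \<Longrightarrow> y \<in> Y\<^sub>2 \<Longrightarrow> {x, y} \<notin> E"
    and rho: "spec_rad (X \<union> Y) E \<ge> spec_rad (M_X n \<union> M_Y m) (M_E n m s t)"
  shows "graph_iso (X \<union> Y) E (M_X n \<union> M_Y m) (M_E n m s t)"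
proof -
  have fin: "finite X" "finite Y" and disj: "X \<inter> Y = {}" using bip by (auto simp: bip_graph_def)
  have iso: "graph_iso (X \<union> Y) (block_graph X Y X\<^sub>1 Y\<^sub>2) (M_X n \<union> M_Y m) (M_E n m s t)"
    by (rule block_graph_iso_M[OF fin disj sub(1,2) card sub(3,4)])
  have ne: "X - X\<^sub>1 \<noteq> {}" "Y - Y\<^sub>2 \<noteq> {}" using sub card by auto
  have "spec_rad (X \<union> Y) (block_graph X Y X\<^sub>1 Y\<^sub>2) = spec_rad (M_X n \<union> M_Y m) (M_E n m s t)"
    using fin ne by (intro spec_rad_iso[OF _ _ iso]) auto
  then have "E = block_graph X Y X\<^sub>1 Y\<^sub>2"
    using block_graph_rigid[OF fin disj sub(1,2) ne subset_block_graphI[OF bip no]] rho by simp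
  then show ?thesis using iso by simp
qed

text \<open>Few missing edges leave only \<open>a = 1\<close> and \<open>b = N - 1\<close>, once
  \<open>b \<le> 2\<close> is excluded by \<open>low_degree_small_side\<close>. Then
  \<open>A\<close> is one vertex of degree at most \<open>k\<close>, whose non-neighbours supply the
  empty block.\<close>

lemma non_biconnected_extremal_i:
  assumes bip: "bip_graph X Y E" and card: "card X = n" "card Y + 1 = n"
    and deg: "min_degree_ge (X \<union> Y) E k" and k: "k = p + 1" "2 * k + 3 \<le> n"
    and rho: "spec_rad (X \<union> Y) E \<ge> spec_rad (M_X n \<union> M_Y (n - 1)) (M_E n (n - 1) 1 (n - k - 1))"
    and non: "\<not> ham_biconnected_2p p X Y E"
  shows "graph_iso (X \<union> Y) E (M_X n \<union> M_Y (n - 1)) (M_E n (n - 1) 1 (n - k - 1))"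
proof -
  have fin: "finite X" "finite Y" and disj: "X \<inter> Y = {}" using bip by (auto simp: bip_graph_def)
  have st: "1 < n" "n - k - 1 < n - 1" using k by auto
  note M = M_spec_rad[OF st refl]
  have "real ((n - 1) * (n - 1)) \<le> (spec_rad (X \<union> Y) E)\<^sup>2"
    by (rule order_trans[OF M(3)]) (use rho M(1) in \<open>intro power_mono, auto\<close>)
  moreover have "spec_rad (X \<union> Y) E > 0" using rho M(1) by linarith
  ultimately have few: "nonedges X Y (\<lambda>x y. {x, y} \<in> E) < n - 1"
    using few_nonedges_i[OF bip card deg] k by auto
  have highY: "degree E y > k + 1" if "y \<in> Y" for y
    using low_degree_small_side[OF bip card _ k(2) that] rho k by fastforce
  define N where "N = n - p"
  obtain a b A B u where s: "u \<in> X" "a + b \<le> N" "A \<subseteq> X" "A \<noteq> {}" "card A = N - b"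
    "B \<subseteq> insert u Y" "B \<noteq> {}" "card B = N - a"
    and dA: "\<And>x. x \<in> A \<Longrightarrow> degree E x \<le> a + p" and dB: "\<And>y. y \<in> B - {u} \<Longrightarrow> degree E y \<le> b + p"
    and uB: "u \<in> B \<Longrightarrow> 2 \<le> b"
    and F: "(N - a - 1) * (N - b) \<le> nonedges X Y (\<lambda>x y. {x, y} \<in> E)"
    by (rule non_biconnected_structure[OF bip card non refl N_def]) (rule that)
  \<comment> \<open>With \<open>k = p + 1\<close>, the hypothesis \<open>2 * k + 3 \<le> n\<close>
    says precisely that \<open>2 * (N - 3)\<close> reaches \<open>n - 1\<close>.\<close>
  have N: "2 * (N - 3) \<ge> n - 1" "N \<ge> 5" using k by (auto simp: N_def)
  have "b \<ge> 3"
  proof (rule ccontr)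
    assume b: "\<not> b \<ge> 3"
    \<comment> \<open>\<open>B = {u}\<close> would give \<open>a = N - 1\<close>, while the
      artificial vertex forces \<open>b \<ge> 2\<close>, against
      \<open>a + b \<le> N\<close>.\<close>
    have "B - {u} \<noteq> {}"
    proof
      assume "B - {u} = {}"
      then have "B = {u}" using s(7) by auto
      then have "N - a = 1" "2 \<le> b" using s(8) uB by auto
      then show False using s(2) by linarith
    qed
    then obtain y where "y \<in> B - {u}" by blast
    then have "degree E y \<le> b + p" "y \<in> Y" using dB s(6) by auto
    then show False using highY[of y] b k by simp
  qed
  obtain x where x: "x \<in> A" using s(4) by blast
  have "k \<le> degree E x" using deg x s(3) by (auto simp: min_degree_ge_def)
  then have a: "a \<ge> 1" using dA[OF x] k by simp
  \<comment> \<open>Otherwise at least \<open>2 * (N - 3)\<close> edges are missing: for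
    \<open>a = 1\<close> because \<open>N - b \<ge> 2\<close>, and for \<open>a \<ge> 2\<close> by
    the concavity bound with \<open>q = 2\<close>.\<close>
  have ab: "a = 1 \<and> b = N - 1"
  proof (rule ccontr)
    assume *: "\<not> ?thesis"
    have "2 * (N - 3) \<le> (N - a - 1) * (N - b)"
    proof (cases "a = 1")
      case True
      then have "b + 2 \<le> N" using * s(2) by auto
      then have "(N - 3) * 2 \<le> (N - a - 1) * (N - b)" using True by (intro mult_le_mono) auto
      then show ?thesis by simp
    next
      case False
      then have "2 * (N - 2 - 1) \<le> (b - 1) * (N - b)"
        using a \<open>b \<ge> 3\<close> s(2) by (intro product_lower_bound) auto
      also have "\<dots> \<le> (N - a - 1) * (N - b)" using s(2) by (intro mult_le_mono) auto
      finally show ?thesis by simp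
    qed
    then show False using F few N by linarith
  qed
  then have "card A = 1" using s(5) N by simp
  then have A: "A = {x}" using x by (metis card_1_singletonE singletonD)
  have "card {y\<in>Y. {x, y} \<in> E} \<le> k"
    using dA[OF x] ab k bip_degree(1)[OF bip] x s(3) by fastforce
  moreover have "card {y\<in>Y. {x, y} \<in> E} + card {y\<in>Y. {x, y} \<notin> E} = n - 1"
    using card_filter_compl[OF fin(2), of "\<lambda>y. {x, y} \<in> E"] card by simp
  ultimately have "n - k - 1 \<le> card {y\<in>Y. {x, y} \<notin> E}" by linarith
  then obtain Y\<^sub>2 where "Y\<^sub>2 \<subseteq> {y\<in>Y. {x, y} \<notin> E}" "card Y\<^sub>2 = n - k - 1"
    by (rule obtain_subset_with_card_n)
  then show ?thesis
    using card s(3) A st rho by (intro extremal_iso[OF bip, of n "n - 1" "{x}" Y\<^sub>2]) auto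
qed

text \<open>The minimum degree gives \<open>a \<ge> q\<close> and \<open>b \<ge> q\<close> for
  \<open>q = k - p\<close>. The bound on missing edges then forces \<open>b = q\<close>,
  \<open>a = N - q\<close>, the artificial vertex in \<open>B\<close>, and an empty block between
  \<open>A\<close> and \<open>B - {u}\<close> of the sizes occurring in \<open>M\<close>.\<close>

lemma non_biconnected_extremal_ii:
  assumes bip: "bip_graph X Y E" and card: "card X = n" "card Y + 1 = n"
    and deg: "min_degree_ge (X \<union> Y) E k" and k: "p + 2 \<le> k" "(k + 2) * (k - p + 1) \<le> 2 * n"
    and rho: "spec_rad (X \<union> Y) E \<ge> spec_rad (M_X n \<union> M_Y (n - 1)) (M_E n (n - 1) (n - k) (k - p - 1))"
    and non: "\<not> ham_biconnected_2p p X Y E"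
  shows "graph_iso (X \<union> Y) E (M_X n \<union> M_Y (n - 1)) (M_E n (n - 1) (n - k) (k - p - 1))"
proof -
  have fin: "finite X" "finite Y" and disj: "X \<inter> Y = {}" using bip by (auto simp: bip_graph_def)
  define q where "q = k - p"
  have q: "2 \<le> q" "q \<le> k" using k by (auto simp: q_def)
  have "(k + 2) * 3 \<le> (k + 2) * (k - p + 1)" using k by (intro mult_le_mono) auto
  then have nk: "k + 3 \<le> n" using k by simp
  have st: "n - k < n" "k - p - 1 < n - 1" using k nk by auto
  note M = M_spec_rad[OF st refl]
  have "n - 1 - (k - p - 1) = n - q" using k nk by (simp add: q_def)
  then have "real (n * (n - q)) \<le> (spec_rad (X \<union> Y) E)\<^sup>2"
    using order_trans[OF M(2) power_mono[OF rho]] M(1) by simp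
  moreover have "spec_rad (X \<union> Y) E > 0" using rho M(1) by linarith
  ultimately have few: "nonedges X Y (\<lambda>x y. {x, y} \<in> E) < q * (n - k - 1)"
    using few_nonedges_ii[OF bip card deg q] k by (simp add: q_def)
  define N where "N = n - p"
  obtain a b A B u where s: "u \<in> X" "a + b \<le> N" "A \<subseteq> X" "A \<noteq> {}" "card A = N - b"
    "B \<subseteq> insert u Y" "B \<noteq> {}" "card B = N - a"
    and dA: "\<And>x. x \<in> A \<Longrightarrow> degree E x \<le> a + p" and dB: "\<And>y. y \<in> B - {u} \<Longrightarrow> degree E y \<le> b + p"
    and uB: "u \<in> B \<Longrightarrow> 2 \<le> b"
    and F: "(N - a - 1) * (N - b) \<le> nonedges X Y (\<lambda>x y. {x, y} \<in> E)"
      "u \<notin> B \<Longrightarrow> (N - a) * (N - b) \<le> nonedges X Y (\<lambda>x y. {x, y} \<in> E)"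
      "a + b = N \<Longrightarrow> u \<in> B \<Longrightarrow>
       (N - a - 1) * (N - b) + (a - 1) \<le> nonedges X Y (\<lambda>x y. {x, y} \<in> E) \<or> (\<forall>x\<in>A. \<forall>y\<in>B - {u}. {x, y} \<notin> E)"
    by (rule non_biconnected_structure[OF bip card non refl N_def]) (rule that)
  have Nq: "N - q = n - k" "N - q - 1 = n - k - 1" "q < N" using k nk by (auto simp: N_def q_def)
  have few': "m < q * (N - q - 1)" if "m \<le> nonedges X Y (\<lambda>x y. {x, y} \<in> E)" for m
    using few that Nq by simp
  obtain x where x: "x \<in> A" using s(4) by blast
  have "k \<le> degree E x" using deg x s(3) by (auto simp: min_degree_ge_def)
  then have a: "q \<le> a" using dA[OF x] k by (simp add: q_def)
  have "B - {u} \<noteq> {}"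
  proof
    assume "B - {u} = {}"
    then have "B = {u}" using s(7) by auto
    then have "N - a = 1" "2 \<le> b" using s(8) uB by auto
    then show False using s(2) by linarith
  qed
  then obtain y where y: "y \<in> B - {u}" by blast
  then have "k \<le> degree E y" using deg s(6) by (auto simp: min_degree_ge_def)
  then have b: "q \<le> b" using dB[OF y] by (simp add: q_def)
  \<comment> \<open>For \<open>b > q\<close> the concavity bound applies, since
    \<open>a \<ge> q\<close> gives \<open>b \<le> N - q\<close>, and already yields too many missing
    edges.\<close>
  have bq: "b = q"
  proof (rule ccontr)
    assume "b \<noteq> q"
    then have "q * (N - q - 1) \<le> (b - 1) * (N - b)"
      using a b s(2) by (intro product_lower_bound) auto
    also have "\<dots> \<le> (N - a - 1) * (N - b)" using s(2) by (intro mult_le_mono) auto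
    finally show False using few'[OF F(1)] by simp
  qed
  \<comment> \<open>Slack in \<open>a + b \<le> N\<close> would give
    \<open>N - a - 1 \<ge> q\<close>, again too many missing edges.\<close>
  have aN: "a + b = N"
  proof (rule ccontr)
    assume "a + b \<noteq> N"
    then have "q * (N - q - 1) \<le> (N - a - 1) * (N - b)"
      using s(2) bq by (intro mult_le_mono) auto
    then show False using few'[OF F(1)] by simp
  qed
  then have Na: "N - a = q" using bq by simp
  \<comment> \<open>If the artificial vertex is not in \<open>B\<close>, no pair is lost in the
    count and \<open>q * (N - q)\<close> edges are missing.\<close>
  have u: "u \<in> B"
  proof (rule ccontr)
    assume "u \<notin> B"
    from few'[OF F(2)[OF this]] have "q * (N - q) < q * (N - q - 1)" by (simp only: Na bq)
    moreover have "q * (N - q - 1) \<le> q * (N - q)"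
      by (rule mult_le_mono2[OF diff_le_self])
    ultimately show False by linarith
  qed
  \<comment> \<open>The \<open>a - 1 = N - q - 1\<close> extra pairs would lift
    \<open>(q - 1) * (N - q)\<close> to at least \<open>q * (N - q - 1)\<close>. So the other
    alternative holds, the empty block.\<close>
  have "\<not> (N - a - 1) * (N - b) + (a - 1) \<le> nonedges X Y (\<lambda>x y. {x, y} \<in> E)"
  proof
    assume "(N - a - 1) * (N - b) + (a - 1) \<le> nonedges X Y (\<lambda>x y. {x, y} \<in> E)"
    from few'[OF this] have lt: "(q - 1) * (N - q) + (a - 1) < q * (N - q - 1)" by (simp add: Na bq)
    have "q * (N - q - 1) = (q - 1) * (N - q - 1) + (N - q - 1)"
      using q by (cases q) auto
    moreover have "(q - 1) * (N - q - 1) \<le> (q - 1) * (N - q)"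
      by (rule mult_le_mono2[OF diff_le_self])
    moreover have "a - 1 = N - q - 1" using aN bq by simp
    ultimately show False using lt by linarith
  qed
  with F(3)[OF aN u] have no: "\<And>x y. x \<in> A \<Longrightarrow> y \<in> B - {u} \<Longrightarrow> {x, y} \<notin> E" by blast
  have finB: "finite B" using s(6) fin by (simp add: finite_subset)
  have "card (B - {u}) = k - p - 1" using u finB s(8) Na by (simp add: q_def)
  moreover have "card A = n - k" using s(5) bq Nq by simp
  moreover have "B - {u} \<subseteq> Y" using s(6) by auto
  moreover have "card Y = n - 1" using card by simp
  ultimately show ?thesis
    using card(1) s(3) st rho no by (intro extremal_iso[OF bip, of n "n - 1" A "B - {u}"]) simp_all
qed

theorem theorem1p7:
  fixes X Y :: "'a set" and E :: "'a set set" and n k p :: nat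
  assumes "bip_graph X Y E" and "nearly_balanced X Y" and "card (X \<union> Y) = 2 * n - 1"
    and "min_degree_ge (X \<union> Y) E k"
  shows "(k = p + 1 \<and> n \<ge> 2 * k + 3 \<and>
           spec_rad (X \<union> Y) E \<ge> spec_rad (M_X n \<union> M_Y (n - 1)) (M_E n (n - 1) 1 (n - k - 1))
           \<longrightarrow> ham_biconnected_2p p X Y E \<or>
               graph_iso (X \<union> Y) E (M_X n \<union> M_Y (n - 1)) (M_E n (n - 1) 1 (n - k - 1)))
       \<and> (k \<ge> p + 2 \<and> real n \<ge> real ((k + 2) * (k - p + 1)) / 2 \<and>
           spec_rad (X \<union> Y) E \<ge> spec_rad (M_X n \<union> M_Y (n - 1)) (M_E n (n - 1) (n - k) (k - p - 1))
           \<longrightarrow> ham_biconnected_2p p X Y E \<or>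
               graph_iso (X \<union> Y) E (M_X n \<union> M_Y (n - 1)) (M_E n (n - 1) (n - k) (k - p - 1)))"
proof -
  have "card (X \<union> Y) = card X + card Y"
    using assms(1) by (simp add: bip_graph_def card_Un_disjoint)
  \<comment> \<open>The order is odd because the sides differ by one, which rules out the truncated
    value of \<open>2 * n - 1\<close> at \<open>n = 0\<close>.\<close>
  then have card: "card X = n" "card Y + 1 = n"
    using assms(2,3) unfolding nearly_balanced_def by arith+
  have half: "(k + 2) * (k - p + 1) \<le> 2 * n" if "real n \<ge> real ((k + 2) * (k - p + 1)) / 2"
  proof -
    have "real ((k + 2) * (k - p + 1)) \<le> real (2 * n)" using that by simp
    then show ?thesis by (simp only: of_nat_le_iff)
  qed
  show ?thesis
    using non_biconnected_extremal_i[OF assms(1) card assms(4)] non_biconnected_extremal_ii[OF assms(1) card assms(4)] half by blast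
qed

end
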